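(* Let $G$ be a $CD1$-group and let $N=\bigcap_{i=1}^{k-1}\ker\chi_i$. Then $$N=\{1\}\cup b^G .$$ Thus $N$ is a minimal normal subgroup of $G$, the order of $b$ equals a prime $p$, and $|N|=p^n$ for some positive integer $n$. Hence $p^n=|N|=1+|b^G|$ and $|b^G|=p^n-1\ge p-1$. In particular, $N$ is an elementary abelian $p$-group, $p\nmid |b^G|$, and $N\le G'$.
   Context: All groups are finite. Let $\mathrm{Irr}(G)=\{\chi_1,\dots,\chi_k\}$ be the set of complex irreducible characters of $G$, with $\chi_1=1_G$ and $\chi_1(1)=1\le\chi_2(1)\le\dots\le\chi_k(1)$. A group $G$ is a $CD1$-group if $|G|>2$ and two columns of its character table differ by exactly one entry, i.e. there are non-conjugate $a,b\in G$ and an index $j$ with $\chi_j(a)\ne\chi_j(b)$ and $\chi_i(a)=\chi_i(b)$ for all $i\ne j$. For a $CD1$-group it is known that one of the two conjugacy classes is $\{1\}$, that the other one, denoted $b^G$, is uniquely determined, and that the two columns differ exactly in the row of $\chi_k$ (so $j=k$). $G'$ is the commutator subgroup of $G$. *)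

theory Defs
  imports
    "HOL-Algebra.Algebra"
    "HOL-Computational_Algebra.Primes"
    "Jordan_Normal_Form.VS_Connect"
begin

section \<open>Complex characters\<close>

definition GL :: "nat \<Rightarrow> complex mat monoid" where
  "GL n = units_of (ring_mat TYPE(complex) n ())"

definition irreducible_rep ::
  "('a, 'b) monoid_scheme \<Rightarrow> nat \<Rightarrow> ('a \<Rightarrow> complex mat) \<Rightarrow> bool" where
  "irreducible_rep G n \<rho> \<longleftrightarrow>
     \<rho> \<in> hom G (GL n) \<and> n > 0 \<and>
     (\<forall>W. VectorSpace.subspace class_ring W (module_vec TYPE(complex) n) \<and>
          (\<forall>g\<in>carrier G. \<forall>w\<in>W. \<rho> g *\<^sub>v w \<in> W) \<longrightarrow>
          W = {0\<^sub>v n} \<or> W = carrier_vec n)"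

definition mat_trace :: "complex mat \<Rightarrow> complex" where
  "mat_trace A = (\<Sum>i<dim_row A. A $$ (i, i))"

text \<open>Characters are \<open>undefined\<close> outside \<open>carrier G\<close>, so that equality of characters is
  equality on \<open>carrier G\<close>.\<close>

definition rep_character ::
  "('a, 'b) monoid_scheme \<Rightarrow> ('a \<Rightarrow> complex mat) \<Rightarrow> 'a \<Rightarrow> complex" where
  "rep_character G \<rho> = (\<lambda>g\<in>carrier G. mat_trace (\<rho> g))"

definition Irr :: "('a, 'b) monoid_scheme \<Rightarrow> ('a \<Rightarrow> complex) set" where
  "Irr G = {rep_character G \<rho> | \<rho> n. irreducible_rep G n \<rho>}"

definition principal_char :: "('a, 'b) monoid_scheme \<Rightarrow> 'a \<Rightarrow> complex" where
  "principal_char G = (\<lambda>g\<in>carrier G. 1)"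

text \<open>The usual definition of the kernel of a character; it is the kernel of any representation
  affording \<open>\<chi>\<close>.\<close>

definition char_ker :: "('a, 'b) monoid_scheme \<Rightarrow> ('a \<Rightarrow> complex) \<Rightarrow> 'a set" where
  "char_ker G \<chi> = {g \<in> carrier G. \<chi> g = \<chi> \<one>\<^bsub>G\<^esub>}"

text \<open>\<open>\<chi> 1, \<dots>, \<chi> k\<close> list the irreducible characters without repetition, the principal
  character first, by nondecreasing degree. Degrees are positive integers, so comparing
  their real parts is comparing the degrees.\<close>

definition Irr_enum ::
  "('a, 'b) monoid_scheme \<Rightarrow> nat \<Rightarrow> (nat \<Rightarrow> 'a \<Rightarrow> complex) \<Rightarrow> bool" where
  "Irr_enum G k \<chi> \<longleftrightarrow>
     bij_betw \<chi> {1..k} (Irr G) \<and>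
     \<chi> 1 = principal_char G \<and>
     (\<forall>i j. 1 \<le> i \<and> i \<le> j \<and> j \<le> k \<longrightarrow> Re (\<chi> i \<one>\<^bsub>G\<^esub>) \<le> Re (\<chi> j \<one>\<^bsub>G\<^esub>))"


section \<open>\<open>CD1\<close>-groups\<close>

definition conj_class :: "('a, 'b) monoid_scheme \<Rightarrow> 'a \<Rightarrow> 'a set" where
  "conj_class G b = {g \<otimes>\<^bsub>G\<^esub> b \<otimes>\<^bsub>G\<^esub> inv\<^bsub>G\<^esub> g | g. g \<in> carrier G}"

definition columns_differ_once :: "('a, 'b) monoid_scheme \<Rightarrow> 'a \<Rightarrow> 'a \<Rightarrow> bool" where
  "columns_differ_once G a b \<longleftrightarrow>
     a \<in> carrier G \<and> b \<in> carrier G \<and> a \<notin> conj_class G b \<and>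
     (\<exists>\<chi>\<in>Irr G. \<chi> a \<noteq> \<chi> b \<and> (\<forall>\<psi>\<in>Irr G. \<psi> \<noteq> \<chi> \<longrightarrow> \<psi> a = \<psi> b))"

definition CD1_group :: "('a, 'b) monoid_scheme \<Rightarrow> bool" where
  "CD1_group G \<longleftrightarrow>
     group G \<and> finite (carrier G) \<and> Coset.order G > 2 \<and> (\<exists>a b. columns_differ_once G a b)"


section \<open>Group-theoretic notions\<close>

definition minimal_normal_subgroup :: "('a, 'b) monoid_scheme \<Rightarrow> 'a set \<Rightarrow> bool" where
  "minimal_normal_subgroup G N \<longleftrightarrow>
     N \<lhd> G \<and> N \<noteq> {\<one>\<^bsub>G\<^esub>} \<and>
     (\<forall>M. M \<lhd> G \<and> M \<subseteq> N \<longrightarrow> M = {\<one>\<^bsub>G\<^esub>} \<or> M = N)"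

definition elementary_abelian :: "nat \<Rightarrow> ('a, 'b) monoid_scheme \<Rightarrow> bool" where
  "elementary_abelian p G \<longleftrightarrow>
     Factorial_Ring.prime p \<and> comm_group G \<and> finite (carrier G) \<and>
     (\<forall>x\<in>carrier G. x [^]\<^bsub>G\<^esub> p = \<one>\<^bsub>G\<^esub>)"

end

theory Submission
  imports Defs "Jordan_Normal_Form.DL_Rank" "Jordan_Normal_Form.Spectral_Radius"
begin

text \<open>Everything follows from two identities for the irreducible characters of a finite group. Write
  \<open>r(a,g)\<close> for the number of \<open>x\<close> with \<open>x a x\<inverse> = g\<close>. The first is column orthogonality,
  \<open>\<Sum>\<psi>. \<psi>(a) \<psi>(g\<inverse>) = r(a,g)\<close> (\<open>second_orthogonality\<close>). The second expresses the class algebra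
  constants, \<open>\<Sum>x. r(x u x\<inverse> v, y) = |G| \<Sum>\<psi>. \<psi>(u) \<psi>(v) \<psi>(y\<inverse>) / \<psi>(1)\<close>
  (\<open>class_product_count\<close>).

  If the columns of \<open>a\<close> and \<open>b\<close> differ only in the row of \<open>\<chi>\<close>, subtracting the orthogonality
  relations gives \<open>(\<chi>(a) - \<chi>(b)) \<chi>(g\<inverse>) = r(a,g) - r(b,g)\<close>. Hence \<open>\<chi>\<close> vanishes at \<open>g\<inverse>\<close>
  unless \<open>g\<close> is conjugate to \<open>a\<close> or \<open>b\<close>. Since \<open>\<chi>(1) \<noteq> 0\<close>, one of \<open>a\<close> and \<open>b\<close> is \<open>1\<close>, say \<open>a\<close>,
  and \<open>\<chi>(g\<inverse>) \<noteq> 0\<close> exactly for \<open>g\<close> in \<open>K = {1} \<union> b\<^sup>G\<close>. The same reasoning applied to the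
  columns of \<open>1\<close> and of any other \<open>g\<close> in the intersection of the kernels of the characters
  \<open>\<psi> \<noteq> \<chi>\<close> shows that this intersection is \<open>K\<close>. The set \<open>K\<close> is closed under multiplication,
  because the class algebra constants at elements outside \<open>K\<close> reduce to orthogonality with the
  column of \<open>1\<close> (\<open>K_mult_closed\<close>).

  The kernels in the theorem omit the last character, so \<open>\<chi>\<close> must be the last one. The relations
  \<open>\<chi>(1)\<^sup>2 |K| = |G| (|K| - 1)\<close> and \<open>\<Sum>\<psi>. \<psi>(1)\<^sup>2 = |G|\<close> show that \<open>\<chi>(1)\<close> exceeds the
  degree of every other nonprincipal character (\<open>\<chi>_degree_dominates\<close>). A normal subgroup whose
  nontrivial elements form one class is minimal normal and elementary abelian by elementary
  group theory (\<open>single_class_normal_subgroup\<close>). For \<open>g\<close> outside \<open>K\<close> and \<open>u\<close> in \<open>K\<close>, the class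
  algebra constants show that \<open>g\<close> is conjugate to \<open>w g\<close> for some conjugate \<open>w\<close> of \<open>u\<close>, which
  puts \<open>u\<close> into the commutator subgroup (\<open>K_subset_derived\<close>); such \<open>g\<close> exist because
  \<open>|G| > 2\<close>.

  Both identities rest on the regular character being \<open>\<Sum>\<psi>. \<psi>(1) \<psi>\<close>. Complete reducibility is
  avoided: traces are additive along composition series, so block triangular form already writes
  any character as a sum of irreducible ones, and first orthogonality, which needs only Schur's
  lemma, finds the multiplicities.\<close>

section \<open>Traces and matrix representations\<close>

lemma mat_trace_commute:
  assumes "A \<in> carrier_mat n m" "B \<in> carrier_mat m n"
  shows "mat_trace (A * B) = mat_trace (B * A)"
proof -
  have "mat_trace (A * B) = (\<Sum>i<n. \<Sum>j<m. A $$ (i,j) * B $$ (j,i))"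
    using assms unfolding mat_trace_def
    by (intro sum.cong) (auto simp: scalar_prod_def lessThan_atLeast0)
  also have "\<dots> = (\<Sum>j<m. \<Sum>i<n. B $$ (j,i) * A $$ (i,j))"
    by (subst sum.swap) (simp add: mult.commute)
  also have "\<dots> = mat_trace (B * A)"
    using assms unfolding mat_trace_def
    by (intro sum.cong) (auto simp: scalar_prod_def lessThan_atLeast0)
  finally show ?thesis .
qed

lemma mat_trace_smult: "A \<in> carrier_mat n n \<Longrightarrow> mat_trace (c \<cdot>\<^sub>m A) = c * mat_trace A"
  unfolding mat_trace_def by (auto simp: sum_distrib_left intro!: sum.cong)

lemma mat_trace_one: "mat_trace (1\<^sub>m n) = of_nat n"
  unfolding mat_trace_def by simp

lemma mat_trace_conj:
  assumes P: "P \<in> carrier_mat n n" and Q: "Q \<in> carrier_mat n n" and inv: "P * Q = 1\<^sub>m n"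
    and A: "A \<in> carrier_mat n n"
  shows "mat_trace (Q * A * P) = mat_trace A"
proof -
  have "mat_trace (Q * A * P) = mat_trace (P * (Q * A))"
    using P Q A by (intro mat_trace_commute[of _ n n]) auto
  also have "P * (Q * A) = (P * Q) * A"
    using P Q A by simp
  finally show ?thesis using inv A by simp
qed

text \<open>Matrices of all sizes share one type, which has no common zero, so an indexed sum has to carry
  its dimensions.\<close>

definition mat_sum :: "nat \<Rightarrow> nat \<Rightarrow> ('i \<Rightarrow> complex mat) \<Rightarrow> 'i set \<Rightarrow> complex mat" where
  "mat_sum n m F I = mat n m (\<lambda>ij. \<Sum>x\<in>I. F x $$ ij)"

lemma mat_sum_carrier[simp]: "mat_sum n m F I \<in> carrier_mat n m"
  by (simp add: mat_sum_def)

lemma mat_sum_cong: "(\<And>x. x \<in> I \<Longrightarrow> F x = H x) \<Longrightarrow> mat_sum n m F I = mat_sum n m H I"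
  by (simp add: mat_sum_def)

lemma mat_sum_reindex:
  assumes "bij_betw h I J"
  shows "mat_sum n m (\<lambda>x. F (h x)) I = mat_sum n m F J"
proof -
  have "(\<Sum>x\<in>I. F (h x) $$ ij) = (\<Sum>y\<in>J. F y $$ ij)" for ij
    by (rule sum.reindex_bij_betw[OF assms, of "\<lambda>y. F y $$ ij"])
  then show ?thesis unfolding mat_sum_def by simp
qed

lemma mult_mat_sum:
  assumes "A \<in> carrier_mat r n" "\<And>x. x \<in> I \<Longrightarrow> F x \<in> carrier_mat n m"
  shows "A * mat_sum n m F I = mat_sum r m (\<lambda>x. A * F x) I"
proof (rule eq_matI)
  fix i j assume "i < dim_row (mat_sum r m (\<lambda>x. A * F x) I)" "j < dim_col (mat_sum r m (\<lambda>x. A * F x) I)"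
  then have i: "i < r" and j: "j < m" by (simp_all add: mat_sum_def)
  have "(\<Sum>k = 0..<n. A $$ (i,k) * (\<Sum>x\<in>I. F x $$ (k,j)))
      = (\<Sum>x\<in>I. \<Sum>k = 0..<n. A $$ (i,k) * F x $$ (k,j))"
    unfolding sum_distrib_left by (rule sum.swap)
  also have "\<dots> = (\<Sum>x\<in>I. (A * F x) $$ (i,j))"
    using assms i j by (intro sum.cong) (fastforce simp: scalar_prod_def)+
  finally show "(A * mat_sum n m F I) $$ (i,j) = mat_sum r m (\<lambda>x. A * F x) I $$ (i,j)"
    using assms(1) i j by (simp add: scalar_prod_def mat_sum_def)
qed (use assms(1) in \<open>auto simp: mat_sum_def\<close>)

lemma mat_sum_mult:
  assumes "A \<in> carrier_mat m r" "\<And>x. x \<in> I \<Longrightarrow> F x \<in> carrier_mat n m"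
  shows "mat_sum n m F I * A = mat_sum n r (\<lambda>x. F x * A) I"
proof (rule eq_matI)
  fix i j assume "i < dim_row (mat_sum n r (\<lambda>x. F x * A) I)" "j < dim_col (mat_sum n r (\<lambda>x. F x * A) I)"
  then have i: "i < n" and j: "j < r" by (simp_all add: mat_sum_def)
  have "(\<Sum>k = 0..<m. (\<Sum>x\<in>I. F x $$ (i,k)) * A $$ (k,j))
      = (\<Sum>x\<in>I. \<Sum>k = 0..<m. F x $$ (i,k) * A $$ (k,j))"
    unfolding sum_distrib_right by (rule sum.swap)
  also have "\<dots> = (\<Sum>x\<in>I. (F x * A) $$ (i,j))"
    using assms i j by (intro sum.cong) (fastforce simp: scalar_prod_def)+
  finally show "(mat_sum n m F I * A) $$ (i,j) = mat_sum n r (\<lambda>x. F x * A) I $$ (i,j)"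
    using assms(1) i j by (simp add: scalar_prod_def mat_sum_def)
qed (use assms(1) in \<open>auto simp: mat_sum_def\<close>)

lemma mat_trace_sum:
  assumes "\<And>x. x \<in> I \<Longrightarrow> F x \<in> carrier_mat n n"
  shows "mat_trace (mat_sum n n F I) = (\<Sum>x\<in>I. mat_trace (F x))"
proof -
  have "mat_trace (mat_sum n n F I) = (\<Sum>i<n. \<Sum>x\<in>I. F x $$ (i,i))"
    by (simp add: mat_trace_def mat_sum_def)
  also have "\<dots> = (\<Sum>x\<in>I. \<Sum>i<n. F x $$ (i,i))" by (rule sum.swap)
  also have "\<dots> = (\<Sum>x\<in>I. mat_trace (F x))"
    using assms by (intro sum.cong) (fastforce simp: mat_trace_def)+
  finally show ?thesis .
qed

lemma GL_simps:
  "carrier (GL n) = Units (ring_mat TYPE(complex) n ())"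
  "monoid.mult (GL n) = (*)" "monoid.one (GL n) = 1\<^sub>m n"
  by (auto simp: GL_def units_of_def ring_mat_simps)

lemma (in group) rep_carrier: "\<rho> \<in> hom G (GL n) \<Longrightarrow> g \<in> carrier G \<Longrightarrow> \<rho> g \<in> carrier_mat n n"
  by (auto simp: hom_def GL_simps Units_def ring_mat_simps)

lemma (in group) rep_mult:
  "\<rho> \<in> hom G (GL n) \<Longrightarrow> g \<in> carrier G \<Longrightarrow> h \<in> carrier G \<Longrightarrow> \<rho> (g \<otimes> h) = \<rho> g * \<rho> h"
  by (auto simp: hom_def GL_simps)

lemma (in group) rep_one:
  assumes \<rho>: "\<rho> \<in> hom G (GL n)"
  shows "\<rho> \<one> = 1\<^sub>m n"
proof -
  interpret R: ring "ring_mat TYPE(complex) n ()" by (rule ring_mat)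
  have "group (GL n)" unfolding GL_def by (rule R.units_group)
  then interpret group_hom G "GL n" \<rho>
    using \<rho> is_group by (simp add: group_hom_def group_hom_axioms_def)
  show ?thesis using hom_one by (simp add: GL_simps)
qed

lemma (in group) rep_inv:
  assumes "\<rho> \<in> hom G (GL n)" "g \<in> carrier G"
  shows "\<rho> (inv g) * \<rho> g = 1\<^sub>m n" "\<rho> g * \<rho> (inv g) = 1\<^sub>m n"
  using assms rep_mult[OF assms(1), of "inv g" g] rep_mult[OF assms(1), of g "inv g"] rep_one[OF assms(1)]
  by auto

lemma (in group) repI:
  assumes "\<And>g. g \<in> carrier G \<Longrightarrow> \<rho> g \<in> carrier_mat n n"
    and "\<And>g h. g \<in> carrier G \<Longrightarrow> h \<in> carrier G \<Longrightarrow> \<rho> (g \<otimes> h) = \<rho> g * \<rho> h"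
    and "\<rho> \<one> = 1\<^sub>m n"
  shows "\<rho> \<in> hom G (GL n)"
proof -
  have "\<rho> g \<in> Units (ring_mat TYPE(complex) n ())" if g: "g \<in> carrier G" for g
    unfolding Units_def ring_mat_simps
    using assms(1)[OF g] assms(1)[of "inv g"] assms(2)[of g "inv g"] assms(2)[of "inv g" g] assms(3) g
    by force
  then show ?thesis using assms by (auto simp: hom_def GL_simps)
qed

section \<open>Schur's lemma\<close>

lemma subspaceI:
  fixes W :: "complex vec set"
  assumes "W \<subseteq> carrier_vec n" "0\<^sub>v n \<in> W"
    and "\<And>v w. v \<in> W \<Longrightarrow> w \<in> W \<Longrightarrow> v + w \<in> W"
    and "\<And>c v. v \<in> W \<Longrightarrow> c \<cdot>\<^sub>v v \<in> W"
  shows "VectorSpace.subspace class_ring W (module_vec TYPE(complex) n)"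
  unfolding subspace_def submodule_def
  using assms vec_vs vec_module by (auto simp: module_vec_simps)

text \<open>The step that turns "the eigenspace is the whole space" into an equation of matrices: compare
  columns by evaluating at unit vectors.\<close>

lemma scalar_mat_if_all_eigenvectors:
  fixes T :: "complex mat"
  assumes T: "T \<in> carrier_mat n n" and ev: "\<And>v. v \<in> carrier_vec n \<Longrightarrow> T *\<^sub>v v = c \<cdot>\<^sub>v v"
  shows "T = c \<cdot>\<^sub>m 1\<^sub>m n"
proof (rule eq_matI)
  fix i j assume ij: "i < dim_row (c \<cdot>\<^sub>m 1\<^sub>m n)" "j < dim_col (c \<cdot>\<^sub>m 1\<^sub>m n)"
  have "T $$ (i,j) = (T *\<^sub>v unit_vec n j) $ i"
    using T ij by simp
  also have "\<dots> = (c \<cdot>\<^sub>m 1\<^sub>m n) $$ (i,j)"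
    using ev[of "unit_vec n j"] ij by auto
  finally show "T $$ (i,j) = (c \<cdot>\<^sub>m 1\<^sub>m n) $$ (i,j)" .
qed (use T in auto)

text \<open>An eigenspace of \<open>T\<close> is invariant under everything that commutes with \<open>T\<close>, and it is nonzero
  for an eigenvalue of \<open>T\<close>; irreducibility makes it the whole space.\<close>

lemma (in group) schur_lemma:
  assumes irr: "irreducible_rep G n \<rho>" and T: "T \<in> carrier_mat n n"
    and comm: "\<And>g. g \<in> carrier G \<Longrightarrow> \<rho> g * T = T * \<rho> g"
  obtains c where "T = c \<cdot>\<^sub>m 1\<^sub>m n"
proof -
  have \<rho>: "\<rho> \<in> hom G (GL n)" and n: "n > 0"
    using irr by (auto simp: irreducible_rep_def)
  obtain c where "c \<in> spectrum T" using spectrum_non_empty[OF T n] by auto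
  then obtain v where v: "v \<in> carrier_vec n" "v \<noteq> 0\<^sub>v n" "T *\<^sub>v v = c \<cdot>\<^sub>v v"
    using T by (auto simp: spectrum_def eigenvalue_def eigenvector_def)
  define W where "W = {v \<in> carrier_vec n. T *\<^sub>v v = c \<cdot>\<^sub>v v}"
  have "VectorSpace.subspace class_ring W (module_vec TYPE(complex) n)"
    by (rule subspaceI)
      (use T in \<open>auto simp: W_def mult_add_distrib_mat_vec smult_add_distrib_vec
         mult_mat_vec smult_smult_assoc mult.commute\<close>)
  moreover have "\<rho> g *\<^sub>v w \<in> W" if g: "g \<in> carrier G" and w: "w \<in> W" for g w
  proof -
    note R = rep_carrier[OF \<rho> g]
    have "T *\<^sub>v (\<rho> g *\<^sub>v w) = (T * \<rho> g) *\<^sub>v w"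
      using T R w by (intro assoc_mult_mat_vec[symmetric]) (auto simp: W_def)
    also have "\<dots> = (\<rho> g * T) *\<^sub>v w" by (simp add: comm[OF g])
    also have "\<dots> = \<rho> g *\<^sub>v (T *\<^sub>v w)"
      using T R w by (intro assoc_mult_mat_vec) (auto simp: W_def)
    also have "\<dots> = c \<cdot>\<^sub>v (\<rho> g *\<^sub>v w)"
      using R w by (auto simp: W_def mult_mat_vec)
    finally show ?thesis using R w by (auto simp: W_def)
  qed
  ultimately have "W = {0\<^sub>v n} \<or> W = carrier_vec n"
    using irr by (auto simp: irreducible_rep_def)
  moreover have "v \<in> W" using v by (simp add: W_def)
  ultimately have "W = carrier_vec n" using v(2) by auto
  then have "T = c \<cdot>\<^sub>m 1\<^sub>m n"
    by (intro scalar_mat_if_all_eigenvectors[OF T]) (auto simp: W_def)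
  then show thesis by (rule that)
qed

section \<open>Splitting characters into irreducible ones\<close>

text \<open>Extend a basis of \<open>W\<close> to one of the whole space and let \<open>P\<close> have these vectors as columns,
  those of \<open>W\<close> first. The last two conclusions together say that \<open>W\<close> is the span of the first
  \<open>m\<close> columns, in the form in which a matrix preserving \<open>W\<close> visibly becomes block triangular.\<close>

lemma subspace_adapted_basis:
  fixes W :: "complex vec set"
  assumes sub: "VectorSpace.subspace class_ring W (module_vec TYPE(complex) n)"
    and ne0: "W \<noteq> {0\<^sub>v n}" and neV: "W \<noteq> carrier_vec n"
  obtains P Q m where "P \<in> carrier_mat n n" "Q \<in> carrier_mat n n" "P * Q = 1\<^sub>m n" "Q * P = 1\<^sub>m n"
    "0 < m" "m < n" "\<And>j. j < m \<Longrightarrow> col P j \<in> W"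
    "\<And>w i. w \<in> W \<Longrightarrow> m \<le> i \<Longrightarrow> i < n \<Longrightarrow> (Q *\<^sub>v w) $ i = 0"
proof -
  interpret vec_space "TYPE(complex)" n .
  have Wc: "W \<subseteq> carrier_vec n" and W0: "0\<^sub>v n \<in> W"
    using submodule.subset[OF is_module[OF sub]] submodule.zero_closed[OF is_module[OF sub]]
    by (auto simp: module_vec_simps)
  have bound: "finite S \<and> card S \<le> n" if "S \<subseteq> carrier_vec n" "lin_indpt S" for S
    using li_le_dim[OF fin_dim _ that(2)] that(1) dim_is_n by auto
  have empty_li: "lin_indpt {}" using unit_vecs_basis subset_li_is_li[of _ "{}"] unfolding basis_def by auto
  have "finite S \<and> card S \<le> n" if "S \<subseteq> W \<and> lin_indpt S" for S
    using bound[of S] that Wc by blast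
  then obtain A where A: "maximal A (\<lambda>S. S \<subseteq> W \<and> lin_indpt S)"
    using maximal_exists[of "\<lambda>S. S \<subseteq> W \<and> lin_indpt S" n "{}"] empty_li by blast
  then have AW: "A \<subseteq> W" and Ali: "lin_indpt A" by (auto simp: maximal_def)
  have Ac: "A \<subseteq> carrier_vec n" using AW Wc by auto
  have W_span: "W \<subseteq> span A"
  proof
    fix w assume w: "w \<in> W"
    show "w \<in> span A"
    proof (cases "w \<in> A")
      case True
      then show ?thesis using in_own_span[of A] Ac by auto
    next
      case False
      then have "lin_dep (A \<union> {w})"
        using A w unfolding maximal_def by blast
      then show ?thesis
        using lin_dep_iff_in_span[of A w] Ac Ali w Wc False by auto
    qed
  qed
  obtain B where B: "maximal B (\<lambda>S. A \<subseteq> S \<and> S \<subseteq> carrier_vec n \<and> lin_indpt S)"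
    using maximal_exists[of "\<lambda>S. A \<subseteq> S \<and> S \<subseteq> carrier_vec n \<and> lin_indpt S" n A] bound Ac Ali by auto
  then have AB: "A \<subseteq> B" and Bc: "B \<subseteq> carrier_vec n" and Bli: "lin_indpt B"
    by (auto simp: maximal_def)
  have "maximal B (\<lambda>S. S \<subseteq> carrier_vec n \<and> lin_indpt S)"
    using B unfolding maximal_def by blast
  then have Bbasis: "basis B" using max_li_is_basis[of B] by simp
  have finB: "finite B" using bound Bc Bli by auto
  have cardB: "card B = n" using dim_basis[OF finB Bbasis] dim_is_n by simp
  have finA: "finite A" using AB finB finite_subset by auto
  define m where "m = card A"
  have m0: "0 < m"
  proof (rule ccontr)
    assume "\<not> 0 < m"
    then have "A = {}" using finA by (simp add: m_def)
    then have "W \<subseteq> {0\<^sub>v n}" using W_span span_empty by simp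
    then show False using W0 ne0 by auto
  qed
  have mn: "m < n"
  proof (rule ccontr)
    assume "\<not> m < n"
    then have "A = B" using cardB AB finB card_mono[OF finB AB] card_subset_eq[OF finB AB] by (simp add: m_def)
    then have "span A = carrier_vec n" using Bbasis unfolding basis_def by simp
    moreover have "span A \<subseteq> W" using span_is_subset[OF AW is_module[OF sub]] .
    ultimately show False using Wc neV by auto
  qed
  obtain xs where xs: "set xs = A" "distinct xs" using finite_distinct_list[OF finA] by auto
  obtain ys where ys: "set ys = B - A" "distinct ys" using finite_distinct_list[of "B - A"] finB by auto
  define vs where "vs = xs @ ys"
  have vs: "set vs = B" "distinct vs" using xs ys AB by (auto simp: vs_def)
  have len: "length vs = n" using distinct_card[OF vs(2)] vs(1) cardB by simp
  have lenx: "length xs = m" using distinct_card[OF xs(2)] xs(1) by (simp add: m_def)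
  define P where "P = mat_of_cols n vs"
  have P: "P \<in> carrier_mat n n" using len unfolding P_def by auto
  have colsP: "cols P = vs" unfolding P_def using vs(1) Bc by simp
  have "rank P = n" using lin_indpt_full_rank[OF P] colsP vs Bli by simp
  then have "det P \<noteq> 0" using det_rank_iff[OF P] by simp
  from det_non_zero_imp_unit[OF P this, of "()"]
  obtain Q where Q: "Q \<in> carrier_mat n n" and QP: "Q * P = 1\<^sub>m n" and PQ: "P * Q = 1\<^sub>m n"
    by (auto simp: Units_def ring_mat_simps)
  have colP: "col P j = vs ! j" if "j < n" for j
    unfolding P_def
  proof (rule col_mat_of_cols)
    show "j < length vs" using that len by simp
    then have "vs ! j \<in> set vs" by (rule nth_mem)
    then show "vs ! j \<in> carrier_vec n" using vs(1) Bc by blast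
  qed
  define U where "U = {v \<in> carrier_vec n. \<forall>i. m \<le> i \<longrightarrow> i < n \<longrightarrow> (Q *\<^sub>v v) $ i = 0}"
  have "VectorSpace.subspace class_ring U V"
  proof (rule subspaceI)
    fix v w assume vw: "v \<in> U" "w \<in> U"
    then have "Q *\<^sub>v (v + w) = Q *\<^sub>v v + Q *\<^sub>v w"
      using Q by (auto simp: U_def intro!: mult_add_distrib_mat_vec)
    then show "v + w \<in> U" using vw Q by (auto simp: U_def simp del: index_mult_mat_vec)
  next
    fix c v assume v: "v \<in> U"
    then have "Q *\<^sub>v (c \<cdot>\<^sub>v v) = c \<cdot>\<^sub>v (Q *\<^sub>v v)"
      using Q by (auto simp: U_def intro!: mult_mat_vec)
    then show "c \<cdot>\<^sub>v v \<in> U" using v Q by (auto simp: U_def simp del: index_mult_mat_vec)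
  next
    show "0\<^sub>v n \<in> U" using Q by (auto simp: U_def)
  qed (auto simp: U_def)
  moreover have "A \<subseteq> U"
  proof
    fix a assume "a \<in> A"
    then obtain j where j: "j < m" "a = xs ! j" using xs(1) lenx by (auto simp: in_set_conv_nth)
    then have a: "a = col P j" using colP[of j] mn lenx by (simp add: vs_def nth_append)
    have "(Q *\<^sub>v a) $ i = 0" if i: "m \<le> i" "i < n" for i
    proof -
      have "(Q *\<^sub>v a) $ i = (Q * P) $$ (i, j)" using Q P i j mn by (simp add: a)
      then show ?thesis using i j mn by (simp add: QP)
    qed
    then show "a \<in> U" using \<open>a \<in> A\<close> Ac by (auto simp: U_def)
  qed
  ultimately have "span A \<subseteq> U" using span_is_subset is_module by blast
  then have WU: "W \<subseteq> U" using W_span by auto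
  show thesis
  proof (rule that[OF P Q PQ QP m0 mn])
    show "col P j \<in> W" if "j < m" for j
    proof -
      have "col P j = xs ! j" using colP[of j] mn lenx that by (simp add: vs_def nth_append)
      moreover have "xs ! j \<in> set xs" using that lenx by (intro nth_mem) simp
      ultimately show ?thesis using xs(1) AW by auto
    qed
    show "(Q *\<^sub>v w) $ i = 0" if "w \<in> W" "m \<le> i" "i < n" for w i
      using that WU by (auto simp: U_def)
  qed
qed

lemma mat_mult_index_sum:
  "A \<in> carrier_mat n k \<Longrightarrow> B \<in> carrier_mat k m \<Longrightarrow> i < n \<Longrightarrow> j < m \<Longrightarrow>
     (A * B) $$ (i,j) = (\<Sum>l<k. A $$ (i,l) * B $$ (l,j))"
  by (simp add: scalar_prod_def lessThan_atLeast0)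

text \<open>In a basis adapted to an invariant subspace every \<open>\<rho> g\<close> is block upper triangular. The two
  diagonal blocks are the representations on the subspace and on the quotient. Only traces are
  compared, so no invariant complement has to be found.\<close>

lemma (in group) reducible_rep_splits:
  assumes \<rho>: "\<rho> \<in> hom G (GL n)" and n: "n > 0" and red: "\<not> irreducible_rep G n \<rho>"
  obtains m \<sigma> \<tau> where "0 < m" "m < n" "\<sigma> \<in> hom G (GL m)" "\<tau> \<in> hom G (GL (n - m))"
    "\<And>g. g \<in> carrier G \<Longrightarrow> mat_trace (\<rho> g) = mat_trace (\<sigma> g) + mat_trace (\<tau> g)"
proof -
  from red \<rho> n obtain W where
    sub: "VectorSpace.subspace class_ring W (module_vec TYPE(complex) n)"
    and inv: "\<And>g w. g \<in> carrier G \<Longrightarrow> w \<in> W \<Longrightarrow> \<rho> g *\<^sub>v w \<in> W"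
    and ne: "W \<noteq> {0\<^sub>v n}" "W \<noteq> carrier_vec n"
    unfolding irreducible_rep_def by blast
  obtain P Q m where P: "P \<in> carrier_mat n n"
    and Q: "Q \<in> carrier_mat n n" and PQ: "P * Q = 1\<^sub>m n" and QP: "Q * P = 1\<^sub>m n"
    and m: "0 < m" "m < n" and colP: "\<And>j. j < m \<Longrightarrow> col P j \<in> W"
    and QW: "\<And>w i. w \<in> W \<Longrightarrow> m \<le> i \<Longrightarrow> i < n \<Longrightarrow> (Q *\<^sub>v w) $ i = 0"
    by (rule subspace_adapted_basis[OF sub ne]) blast
  define \<beta> where "\<beta> g = Q * \<rho> g * P" for g
  note R = rep_carrier[OF \<rho>]
  have \<beta>: "\<beta> g \<in> carrier_mat n n" if "g \<in> carrier G" for g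
    using P Q R[OF that] by (simp add: \<beta>_def)
  have \<beta>_mult: "\<beta> (g \<otimes> h) = \<beta> g * \<beta> h" if g: "g \<in> carrier G" and h: "h \<in> carrier G" for g h
  proof -
    have "\<beta> g * \<beta> h = Q * \<rho> g * (P * Q) * (\<rho> h * P)"
      unfolding \<beta>_def using P Q R[OF g] R[OF h]
      by (simp add: assoc_mult_mat[of _ n n _ n _ n])
    then show ?thesis
      unfolding \<beta>_def PQ using P Q R[OF g] R[OF h] rep_mult[OF \<rho> g h]
      by (simp add: assoc_mult_mat[of _ n n _ n _ n])
  qed
  have \<beta>_one: "\<beta> \<one> = 1\<^sub>m n" unfolding \<beta>_def using rep_one[OF \<rho>] Q QP by simp
  have lower_left: "\<beta> g $$ (i,j) = 0" if g: "g \<in> carrier G" and i: "m \<le> i" "i < n" and j: "j < m" for g i j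
  proof -
    have "\<beta> g = Q * (\<rho> g * P)" unfolding \<beta>_def using P Q R[OF g] by simp
    moreover have "col (\<rho> g * P) j = \<rho> g *\<^sub>v col P j"
      using P R[OF g] j m(2) by (intro col_mult2[of _ n n _ n]) auto
    ultimately have "\<beta> g $$ (i,j) = (Q *\<^sub>v (\<rho> g *\<^sub>v col P j)) $ i"
      using P Q R[OF g] i j m(2) by simp
    then show ?thesis using QW[OF inv[OF g colP[OF j]] i] by simp
  qed
  define \<sigma> where "\<sigma> g = mat m m (\<lambda>(i,j). \<beta> g $$ (i,j))" for g
  define \<tau> where "\<tau> g = mat (n-m) (n-m) (\<lambda>(i,j). \<beta> g $$ (i+m,j+m))" for g
  have \<sigma>c: "\<sigma> g \<in> carrier_mat m m" and \<tau>c: "\<tau> g \<in> carrier_mat (n-m) (n-m)" for g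
    by (auto simp: \<sigma>_def \<tau>_def)
  have split: "(\<Sum>l<n. f l) = (\<Sum>l<m. f l) + (\<Sum>l<n-m. f (l+m))" for f :: "nat \<Rightarrow> complex"
    using m(2) sum.atLeastLessThan_concat[of 0 m n f]
      sum.shift_bounds_nat_ivl[of f 0 m "n-m"] by (simp add: lessThan_atLeast0)
  have \<sigma>: "\<sigma> \<in> hom G (GL m)"
  proof (rule repI)
    show "\<sigma> (g \<otimes> h) = \<sigma> g * \<sigma> h" if g: "g \<in> carrier G" and h: "h \<in> carrier G" for g h
    proof (rule eq_matI)
      fix i j assume "i < dim_row (\<sigma> g * \<sigma> h)" "j < dim_col (\<sigma> g * \<sigma> h)"
      then have i: "i < m" and j: "j < m" by (auto simp: \<sigma>_def)
      have "\<sigma> (g \<otimes> h) $$ (i,j) = (\<Sum>l<n. \<beta> g $$ (i,l) * \<beta> h $$ (l,j))"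
        using i j m mat_mult_index_sum[OF \<beta>[OF g] \<beta>[OF h], of i j] by (simp add: \<sigma>_def \<beta>_mult[OF g h])
      also have "\<dots> = (\<Sum>l<m. \<beta> g $$ (i,l) * \<beta> h $$ (l,j))"
        using lower_left[OF h _ _ j] by (simp add: split)
      also have "\<dots> = (\<sigma> g * \<sigma> h) $$ (i,j)"
        unfolding mat_mult_index_sum[OF \<sigma>c \<sigma>c i j] using i j by (simp add: \<sigma>_def)
      finally show "\<sigma> (g \<otimes> h) $$ (i,j) = (\<sigma> g * \<sigma> h) $$ (i,j)" .
    qed (auto simp: \<sigma>_def)
    show "\<sigma> \<one> = 1\<^sub>m m" by (rule eq_matI) (use m in \<open>auto simp: \<sigma>_def \<beta>_one\<close>)
  qed (rule \<sigma>c)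
  have \<tau>: "\<tau> \<in> hom G (GL (n-m))"
  proof (rule repI)
    show "\<tau> (g \<otimes> h) = \<tau> g * \<tau> h" if g: "g \<in> carrier G" and h: "h \<in> carrier G" for g h
    proof (rule eq_matI)
      fix i j assume "i < dim_row (\<tau> g * \<tau> h)" "j < dim_col (\<tau> g * \<tau> h)"
      then have i: "i < n-m" and j: "j < n-m" by (auto simp: \<tau>_def)
      have "\<tau> (g \<otimes> h) $$ (i,j) = (\<Sum>l<n. \<beta> g $$ (i+m,l) * \<beta> h $$ (l,j+m))"
        using i j m mat_mult_index_sum[OF \<beta>[OF g] \<beta>[OF h], of "i+m" "j+m"]
        by (simp add: \<tau>_def \<beta>_mult[OF g h])
      also have "\<dots> = (\<Sum>l<n-m. \<beta> g $$ (i+m,l+m) * \<beta> h $$ (l+m,j+m))"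
        using lower_left[OF g, of "i+m"] i by (simp add: split)
      also have "\<dots> = (\<tau> g * \<tau> h) $$ (i,j)"
        unfolding mat_mult_index_sum[OF \<tau>c \<tau>c i j] using i j by (simp add: \<tau>_def)
      finally show "\<tau> (g \<otimes> h) $$ (i,j) = (\<tau> g * \<tau> h) $$ (i,j)" .
    qed (auto simp: \<tau>_def)
    show "\<tau> \<one> = 1\<^sub>m (n-m)" by (rule eq_matI) (use m in \<open>auto simp: \<tau>_def \<beta>_one\<close>)
  qed (rule \<tau>c)
  have "mat_trace (\<rho> g) = mat_trace (\<sigma> g) + mat_trace (\<tau> g)" if g: "g \<in> carrier G" for g
  proof -
    have "mat_trace (\<rho> g) = mat_trace (\<beta> g)"
      unfolding \<beta>_def using mat_trace_conj[OF P Q PQ R[OF g]] by simp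
    also have "\<dots> = (\<Sum>l<n. \<beta> g $$ (l,l))" using \<beta>[OF g] by (simp add: mat_trace_def)
    finally show ?thesis by (simp add: split mat_trace_def \<sigma>_def \<tau>_def)
  qed
  then show thesis using that[OF m \<sigma> \<tau>] by blast
qed

text \<open>The additivity of the trace along a composition series; the list records the composition
  factors with multiplicity.\<close>

lemma (in group) rep_trace_sum_of_irreducibles:
  "\<rho> \<in> hom G (GL n) \<Longrightarrow>
     \<exists>xs. set xs \<subseteq> Irr G \<and> (\<forall>g\<in>carrier G. mat_trace (\<rho> g) = (\<Sum>\<psi>\<leftarrow>xs. \<psi> g))"
proof (induction n arbitrary: \<rho> rule: less_induct)
  case (less n)
  note R = rep_carrier[OF less.prems]
  consider "n = 0" | "irreducible_rep G n \<rho>" | "n > 0" "\<not> irreducible_rep G n \<rho>" by blast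
  then show ?case
  proof cases
    case 1
    have "mat_trace (\<rho> g) = 0" if "g \<in> carrier G" for g
      using R[OF that] 1 by (simp add: mat_trace_def)
    then show ?thesis by (intro exI[of _ "[]"]) simp
  next
    case 2
    then have "rep_character G \<rho> \<in> Irr G" by (auto simp: Irr_def)
    then show ?thesis by (intro exI[of _ "[rep_character G \<rho>]"]) (simp add: rep_character_def)
  next
    case 3
    obtain m \<sigma> \<tau> where m: "0 < m" "m < n"
      and \<sigma>: "\<sigma> \<in> hom G (GL m)" and \<tau>: "\<tau> \<in> hom G (GL (n - m))"
      and tr: "\<And>g. g \<in> carrier G \<Longrightarrow> mat_trace (\<rho> g) = mat_trace (\<sigma> g) + mat_trace (\<tau> g)"
      by (rule reducible_rep_splits[OF less.prems 3]) blast
    obtain xs where "set xs \<subseteq> Irr G" "\<forall>g\<in>carrier G. mat_trace (\<sigma> g) = (\<Sum>\<psi>\<leftarrow>xs. \<psi> g)"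
      using less.IH[OF m(2) \<sigma>] by auto
    moreover obtain ys where "set ys \<subseteq> Irr G" "\<forall>g\<in>carrier G. mat_trace (\<tau> g) = (\<Sum>\<psi>\<leftarrow>ys. \<psi> g)"
      using less.IH[OF _ \<tau>] m by auto
    ultimately show ?thesis using tr by (intro exI[of _ "xs @ ys"]) auto
  qed
qed

section \<open>Averaging and first orthogonality\<close>

locale finite_group = group +
  assumes finite_carrier: "finite (carrier G)"
begin

lemma order_pos: "card (carrier G) > 0"
  using finite_carrier one_closed by (metis card_gt_0_iff empty_iff)

lemma bij_left_mult: "g \<in> carrier G \<Longrightarrow> bij_betw (\<lambda>x. g \<otimes> x) (carrier G) (carrier G)"
  by (rule bij_betw_byWitness[where f' = "\<lambda>x. inv g \<otimes> x"]) (auto simp: m_assoc[symmetric])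

text \<open>The projection of a matrix onto the space of intertwiners, up to the factor \<open>|G|\<close>.\<close>

definition average :: "('a \<Rightarrow> complex mat) \<Rightarrow> ('a \<Rightarrow> complex mat) \<Rightarrow> complex mat \<Rightarrow> complex mat" where
  "average \<sigma> \<rho> A = mat_sum (dim_row A) (dim_col A) (\<lambda>x. \<sigma> x * A * \<rho> (inv x)) (carrier G)"

lemma average_carrier: "A \<in> carrier_mat n m \<Longrightarrow> average \<sigma> \<rho> A \<in> carrier_mat n m"
  using mat_sum_carrier by (auto simp: average_def)

lemma sandwich_carrier:
  assumes "\<rho> \<in> hom G (GL m)" "\<sigma> \<in> hom G (GL n)" "A \<in> carrier_mat n m" "x \<in> carrier G"
  shows "\<sigma> x * A * \<rho> (inv x) \<in> carrier_mat n m"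
  using rep_carrier[OF assms(2,4)] rep_carrier[OF assms(1), of "inv x"] assms(3,4) by simp

text \<open>Left translation by \<open>g\<close> permutes the summands.\<close>

lemma average_intertwines:
  assumes \<rho>: "\<rho> \<in> hom G (GL m)" and \<sigma>: "\<sigma> \<in> hom G (GL n)" and A: "A \<in> carrier_mat n m"
    and g: "g \<in> carrier G"
  shows "\<sigma> g * average \<sigma> \<rho> A = average \<sigma> \<rho> A * \<rho> g"
proof -
  have c: "\<sigma> x * A * \<rho> (inv x) \<in> carrier_mat n m" if "x \<in> carrier G" for x
    by (rule sandwich_carrier[OF \<rho> \<sigma> A that])
  have av: "average \<sigma> \<rho> A = mat_sum n m (\<lambda>x. \<sigma> x * A * \<rho> (inv x)) (carrier G)"
    using A by (simp add: average_def)
  have "\<sigma> g * average \<sigma> \<rho> A = mat_sum n m (\<lambda>x. \<sigma> g * (\<sigma> x * A * \<rho> (inv x))) (carrier G)"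
    unfolding av by (rule mult_mat_sum[OF rep_carrier[OF \<sigma> g]]) (rule c)
  also have "\<dots> = mat_sum n m (\<lambda>x. (\<sigma> (g \<otimes> x) * A * \<rho> (inv (g \<otimes> x))) * \<rho> g) (carrier G)"
  proof (rule mat_sum_cong)
    fix x assume x: "x \<in> carrier G"
    have "\<rho> (inv (g \<otimes> x)) * \<rho> g = \<rho> (inv (g \<otimes> x) \<otimes> g)"
      using g x by (simp add: rep_mult[OF \<rho>])
    also have "inv (g \<otimes> x) \<otimes> g = inv x" using g x by (simp add: inv_mult_group m_assoc)
    finally have "\<rho> (inv (g \<otimes> x)) * \<rho> g = \<rho> (inv x)" .
    moreover have "(\<sigma> (g \<otimes> x) * A * \<rho> (inv (g \<otimes> x))) * \<rho> g
        = \<sigma> (g \<otimes> x) * A * (\<rho> (inv (g \<otimes> x)) * \<rho> g)"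
      using A rep_carrier[OF \<sigma>, of "g \<otimes> x"] rep_carrier[OF \<rho> g] rep_carrier[OF \<rho>, of "inv (g \<otimes> x)"] g x
      by (intro assoc_mult_mat) auto
    moreover have "\<sigma> (g \<otimes> x) * A * \<rho> (inv x) = \<sigma> g * (\<sigma> x * A * \<rho> (inv x))"
      unfolding rep_mult[OF \<sigma> g x]
      using A rep_carrier[OF \<sigma> g] rep_carrier[OF \<sigma> x] rep_carrier[OF \<rho>, of "inv x"] x
      by (simp add: assoc_mult_mat[of _ n n _ n _ m] assoc_mult_mat[of _ n n _ m _ m])
    ultimately show "\<sigma> g * (\<sigma> x * A * \<rho> (inv x)) = (\<sigma> (g \<otimes> x) * A * \<rho> (inv (g \<otimes> x))) * \<rho> g"
      by simp
  qed
  also have "\<dots> = mat_sum n m (\<lambda>x. (\<sigma> x * A * \<rho> (inv x)) * \<rho> g) (carrier G)"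
    using mat_sum_reindex[OF bij_left_mult[OF g], of n m "\<lambda>x. (\<sigma> x * A * \<rho> (inv x)) * \<rho> g"] by simp
  also have "\<dots> = average \<sigma> \<rho> A * \<rho> g"
    unfolding av by (rule mat_sum_mult[OF rep_carrier[OF \<rho> g], symmetric]) (rule c)
  finally show ?thesis .
qed

lemma mat_trace_average:
  assumes \<rho>: "\<rho> \<in> hom G (GL n)" and A: "A \<in> carrier_mat n n"
  shows "mat_trace (average \<rho> \<rho> A) = of_nat (card (carrier G)) * mat_trace A"
proof -
  have "mat_trace (average \<rho> \<rho> A) = (\<Sum>x\<in>carrier G. mat_trace (\<rho> x * A * \<rho> (inv x)))"
    using A sandwich_carrier[OF \<rho> \<rho> A] by (simp add: average_def mat_trace_sum)
  also have "\<dots> = (\<Sum>x\<in>carrier G. mat_trace A)"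
    using A rep_carrier[OF \<rho>] rep_inv[OF \<rho>]
    by (intro sum.cong mat_trace_conj[of _ n]) auto
  finally show ?thesis by simp
qed

text \<open>Schur's lemma gives a scalar matrix, and the trace identifies the scalar.\<close>

lemma average_scalar:
  assumes irr: "irreducible_rep G n \<rho>" and A: "A \<in> carrier_mat n n"
  obtains c where "average \<rho> \<rho> A = c \<cdot>\<^sub>m 1\<^sub>m n" "c * of_nat n = of_nat (card (carrier G)) * mat_trace A"
proof -
  have \<rho>: "\<rho> \<in> hom G (GL n)" using irr by (simp add: irreducible_rep_def)
  obtain c where c: "average \<rho> \<rho> A = c \<cdot>\<^sub>m 1\<^sub>m n"
    using schur_lemma[OF irr average_carrier[OF A, of \<rho> \<rho>]] average_intertwines[OF \<rho> \<rho> A] by blast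
  have "c * of_nat n = mat_trace (average \<rho> \<rho> A)"
    by (simp add: c mat_trace_smult[of _ n] mat_trace_one)
  then show thesis using that[OF c] mat_trace_average[OF \<rho> A] by simp
qed

definition unit_mat :: "nat \<Rightarrow> nat \<Rightarrow> nat \<Rightarrow> nat \<Rightarrow> complex mat" where
  "unit_mat n m i j = mat n m (\<lambda>(r,s). if r = i \<and> s = j then 1 else 0)"

lemma unit_mat_carrier[simp]: "unit_mat n m i j \<in> carrier_mat n m"
  by (simp add: unit_mat_def)

lemma unit_mat_sandwich:
  assumes "A \<in> carrier_mat n n" "B \<in> carrier_mat m m" "i < n" "j < m" "r < n" "s < m"
  shows "(A * unit_mat n m i j * B) $$ (r,s) = A $$ (r,i) * B $$ (j,s)"
proof -
  have "(A * unit_mat n m i j) $$ (r,l) = (if l = j then A $$ (r,i) else 0)" if "l < m" for l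
  proof -
    have "(A * unit_mat n m i j) $$ (r,l) = (\<Sum>k<n. if k = i then (if l = j then A $$ (r,i) else 0) else 0)"
      unfolding mat_mult_index_sum[OF assms(1) unit_mat_carrier assms(5) that]
      using that by (intro sum.cong) (auto simp: unit_mat_def)
    then show ?thesis using assms(3) by simp
  qed
  moreover have "A * unit_mat n m i j \<in> carrier_mat n m" using assms(1) by simp
  ultimately have "(A * unit_mat n m i j * B) $$ (r,s) = (\<Sum>l<m. (if l = j then A $$ (r,i) else 0) * B $$ (l,s))"
    using assms mat_mult_index_sum[of "A * unit_mat n m i j" n m B m r s] by simp
  also have "\<dots> = (\<Sum>l<m. if l = j then A $$ (r,i) * B $$ (j,s) else 0)"
    by (rule sum.cong) auto
  finally show ?thesis using assms(4) by simp
qed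

lemma mat_trace_unit_mat: "i < n \<Longrightarrow> j < n \<Longrightarrow> mat_trace (unit_mat n n i j) = (if i = j then 1 else 0)"
proof -
  assume "i < n" "j < n"
  have "mat_trace (unit_mat n n i j) = (\<Sum>k<n. if k = i then (if i = j then 1 else 0) else 0)"
    unfolding mat_trace_def by (intro sum.cong) (auto simp: unit_mat_def)
  then show ?thesis using \<open>i < n\<close> by simp
qed

text \<open>The left side is a sum of products of diagonal coefficients, and sandwiching a matrix unit
  between two matrices extracts exactly such a product. This reduces orthogonality of characters
  to knowing the averages of the matrix units.\<close>

lemma character_product_as_averages:
  assumes \<rho>: "\<rho> \<in> hom G (GL m)" and \<sigma>: "\<sigma> \<in> hom G (GL n)"
  shows "(\<Sum>g\<in>carrier G. mat_trace (\<sigma> g) * mat_trace (\<rho> (inv g)))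
       = (\<Sum>i<n. \<Sum>j<m. average \<sigma> \<rho> (unit_mat n m i j) $$ (i,j))"
proof -
  have "average \<sigma> \<rho> (unit_mat n m i j) $$ (i,j) = (\<Sum>g\<in>carrier G. \<sigma> g $$ (i,i) * \<rho> (inv g) $$ (j,j))"
    if ij: "i < n" "j < m" for i j
    using ij unit_mat_sandwich[OF rep_carrier[OF \<sigma>] rep_carrier[OF \<rho>], OF _ inv_closed ij ij]
    by (simp add: average_def mat_sum_def unit_mat_def[of n m i j, THEN arg_cong[where f = dim_row]]
          unit_mat_def[of n m i j, THEN arg_cong[where f = dim_col]])
  then have "(\<Sum>i<n. \<Sum>j<m. average \<sigma> \<rho> (unit_mat n m i j) $$ (i,j))
      = (\<Sum>i<n. \<Sum>j<m. \<Sum>g\<in>carrier G. \<sigma> g $$ (i,i) * \<rho> (inv g) $$ (j,j))"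
    by simp
  also have "\<dots> = (\<Sum>g\<in>carrier G. \<Sum>i<n. \<Sum>j<m. \<sigma> g $$ (i,i) * \<rho> (inv g) $$ (j,j))"
    by (simp only: sum.swap[of _ "carrier G"])
  also have "\<dots> = (\<Sum>g\<in>carrier G. mat_trace (\<sigma> g) * mat_trace (\<rho> (inv g)))"
  proof (rule sum.cong)
    fix g assume g: "g \<in> carrier G"
    have "dim_row (\<sigma> g) = n" "dim_row (\<rho> (inv g)) = m"
      using rep_carrier[OF \<sigma> g] rep_carrier[OF \<rho> inv_closed[OF g]] by auto
    then show "(\<Sum>i<n. \<Sum>j<m. \<sigma> g $$ (i,i) * \<rho> (inv g) $$ (j,j)) = mat_trace (\<sigma> g) * mat_trace (\<rho> (inv g))"
      by (simp add: mat_trace_def sum_product)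
  qed simp
  finally show ?thesis by simp
qed

text \<open>A nonzero intertwiner is invertible, but this proof never compares dimensions. Averaging a
  suitable matrix unit \<open>B\<close> gives an intertwiner \<open>S\<close> in the other direction with
  \<open>tr (S T) = |G| tr (B T) \<noteq> 0\<close>. By Schur's lemma \<open>S T\<close> and \<open>T S\<close> are scalar; the
  scalars agree because \<open>T (S T) = (T S) T\<close>, and cyclicity of the trace then moves \<open>\<rho> g\<close>
  across \<open>S\<close> and \<open>T\<close>.\<close>

lemma intertwined_irreducibles_same_trace:
  assumes irr\<rho>: "irreducible_rep G m \<rho>" and irr\<sigma>: "irreducible_rep G n \<sigma>"
    and T: "T \<in> carrier_mat n m" and T0: "T \<noteq> 0\<^sub>m n m"
    and comm: "\<And>g. g \<in> carrier G \<Longrightarrow> \<sigma> g * T = T * \<rho> g"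
    and g: "g \<in> carrier G"
  shows "mat_trace (\<rho> g) = mat_trace (\<sigma> g)"
proof -
  have \<rho>: "\<rho> \<in> hom G (GL m)" and \<sigma>: "\<sigma> \<in> hom G (GL n)"
    using irr\<rho> irr\<sigma> by (auto simp: irreducible_rep_def)
  note R = rep_carrier[OF \<rho>] and S' = rep_carrier[OF \<sigma>]
  obtain i j where ij: "i < n" "j < m" "T $$ (i,j) \<noteq> 0"
    using T T0 by (metis carrier_matD eq_matI index_zero_mat)
  define B where "B = unit_mat m n j i"
  have B: "B \<in> carrier_mat m n" by (simp add: B_def)
  define S where "S = average \<rho> \<sigma> B"
  have S: "S \<in> carrier_mat m n" unfolding S_def by (rule average_carrier[OF B])
  have Scomm: "\<rho> h * S = S * \<sigma> h" if "h \<in> carrier G" for h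
    unfolding S_def using average_intertwines[OF \<sigma> \<rho> B that] .
  have ST: "S * T \<in> carrier_mat m m" and TS: "T * S \<in> carrier_mat n n" using S T by auto
  have "\<rho> h * (S * T) = (S * T) * \<rho> h" if h: "h \<in> carrier G" for h
  proof -
    have "\<rho> h * (S * T) = (\<rho> h * S) * T" using R[OF h] S T by simp
    also have "\<dots> = S * (\<sigma> h * T)" using S'[OF h] S T by (simp add: Scomm[OF h])
    also have "\<dots> = (S * T) * \<rho> h" using R[OF h] S T by (simp add: comm[OF h])
    finally show ?thesis .
  qed
  then obtain c where c: "S * T = c \<cdot>\<^sub>m 1\<^sub>m m" using schur_lemma[OF irr\<rho> ST] by blast
  have "\<sigma> h * (T * S) = (T * S) * \<sigma> h" if h: "h \<in> carrier G" for h
  proof -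
    have "\<sigma> h * (T * S) = (\<sigma> h * T) * S" using S'[OF h] S T by simp
    also have "\<dots> = T * (\<rho> h * S)" using R[OF h] S T by (simp add: comm[OF h])
    also have "\<dots> = (T * S) * \<sigma> h" using S'[OF h] S T by (simp add: Scomm[OF h])
    finally show ?thesis .
  qed
  then obtain d where d: "T * S = d \<cdot>\<^sub>m 1\<^sub>m n" using schur_lemma[OF irr\<sigma> TS] by blast
  have "S * T = average \<rho> \<rho> (B * T)"
  proof -
    have "S * T = mat_sum m m (\<lambda>x. \<rho> x * B * \<sigma> (inv x) * T) (carrier G)"
      using B T sandwich_carrier[OF \<sigma> \<rho> B] unfolding S_def average_def
      by (simp add: mat_sum_mult[of T n m])
    also have "\<dots> = mat_sum m m (\<lambda>x. \<rho> x * (B * T) * \<rho> (inv x)) (carrier G)"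
    proof (rule mat_sum_cong)
      fix x assume x: "x \<in> carrier G"
      have "\<rho> x * B * \<sigma> (inv x) * T = \<rho> x * B * (\<sigma> (inv x) * T)"
        using B T R[OF x] S'[of "inv x"] x by (intro assoc_mult_mat) auto
      also have "\<dots> = \<rho> x * B * (T * \<rho> (inv x))" using comm x by simp
      also have "\<dots> = \<rho> x * (B * T) * \<rho> (inv x)"
        using B T R[OF x] R[of "inv x"] x
        by (simp add: assoc_mult_mat[of _ m m _ n _ m] assoc_mult_mat[of _ m n _ m _ m]
            assoc_mult_mat[of _ m m _ m _ m])
      finally show "\<rho> x * B * \<sigma> (inv x) * T = \<rho> x * (B * T) * \<rho> (inv x)" .
    qed
    also have "\<dots> = average \<rho> \<rho> (B * T)" using B T by (simp add: average_def)
    finally show ?thesis .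
  qed
  then have "mat_trace (S * T) = of_nat (card (carrier G)) * mat_trace (B * T)"
    using mat_trace_average[OF \<rho>, of "B * T"] B T by simp
  moreover have "mat_trace (B * T) = T $$ (i,j)"
  proof -
    have "mat_trace (B * T) = (\<Sum>k<m. if k = j then T $$ (i,j) else 0)"
    proof -
      have "(B * T) $$ (k,k) = (if k = j then T $$ (i,j) else 0)" if k: "k < m" for k
      proof -
        have "(B * T) $$ (k,k) = (\<Sum>l<n. if l = i then (if k = j then T $$ (i,j) else 0) else 0)"
          unfolding mat_mult_index_sum[OF B T k k]
          using k by (intro sum.cong) (auto simp: B_def unit_mat_def)
        then show ?thesis using ij(1) by simp
      qed
      then show ?thesis using B by (simp add: mat_trace_def)
    qed
    then show ?thesis using ij(2) by simp
  qed
  moreover have "mat_trace (S * T) = c * of_nat m"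
    by (simp add: c mat_trace_smult[of _ m] mat_trace_one)
  ultimately have c0: "c \<noteq> 0" using ij(3) order_pos by auto
  have "c \<cdot>\<^sub>m T = d \<cdot>\<^sub>m T"
  proof -
    have "c \<cdot>\<^sub>m T = T * (S * T)" using T by (simp add: c mult_smult_distrib[of _ n m _ m])
    also have "\<dots> = (T * S) * T" using S T by simp
    also have "\<dots> = d \<cdot>\<^sub>m T" using T by (simp add: d mult_smult_assoc_mat[of _ n n _ m])
    finally show ?thesis .
  qed
  then have "(c \<cdot>\<^sub>m T) $$ (i,j) = (d \<cdot>\<^sub>m T) $$ (i,j)" by simp
  then have cd: "c = d" using T ij by simp
  have "c * mat_trace (\<rho> g) = mat_trace (\<rho> g * (S * T))"
    using R[OF g] by (simp add: c mat_trace_smult[of _ m] mult_smult_distrib[of _ m m _ m])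
  also have "\<rho> g * (S * T) = S * (\<sigma> g * T)"
  proof -
    have "\<rho> g * (S * T) = (\<rho> g * S) * T" using R[OF g] S T by simp
    then show ?thesis using S'[OF g] S T by (simp add: Scomm[OF g])
  qed
  also have "mat_trace (S * (\<sigma> g * T)) = mat_trace (\<sigma> g * T * S)"
    using S'[OF g] S T by (intro mat_trace_commute[of _ m n]) auto
  also have "\<sigma> g * T * S = \<sigma> g * (T * S)" using S'[OF g] S T by simp
  also have "mat_trace (\<sigma> g * (T * S)) = c * mat_trace (\<sigma> g)"
    using S'[OF g] by (simp add: d cd mat_trace_smult[of _ n] mult_smult_distrib[of _ n n _ n])
  finally show ?thesis using c0 by simp
qed

lemma IrrE:
  assumes "\<chi> \<in> Irr G"
  obtains n \<rho> where "irreducible_rep G n \<rho>" "\<rho> \<in> hom G (GL n)" "n > 0" "\<chi> = rep_character G \<rho>"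
    "\<And>g. g \<in> carrier G \<Longrightarrow> \<chi> g = mat_trace (\<rho> g)"
  using assms unfolding Irr_def irreducible_rep_def by (auto simp: rep_character_def)

lemma degree_pos_nat:
  assumes "\<chi> \<in> Irr G"
  obtains n where "n > 0" "\<chi> \<one> = of_nat n"
proof -
  obtain n \<rho> where \<rho>: "\<rho> \<in> hom G (GL n)" "n > 0" "\<chi> = rep_character G \<rho>"
    using assms by (rule IrrE)
  then show thesis using that[of n] rep_one[OF \<rho>(1)] by (simp add: rep_character_def mat_trace_one)
qed

text \<open>For different characters every average of a matrix unit vanishes, since a nonzero one would be
  an intertwiner. For equal characters the averages are scalars known from their traces.\<close>

theorem first_orthogonality:
  assumes "\<chi> \<in> Irr G" "\<psi> \<in> Irr G"
  shows "(\<Sum>g\<in>carrier G. \<chi> g * \<psi> (inv g)) = (if \<chi> = \<psi> then of_nat (card (carrier G)) else 0)"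
proof -
  obtain n \<sigma> where \<sigma>: "irreducible_rep G n \<sigma>" "\<sigma> \<in> hom G (GL n)" "n > 0" "\<chi> = rep_character G \<sigma>"
    "\<And>g. g \<in> carrier G \<Longrightarrow> \<chi> g = mat_trace (\<sigma> g)" using IrrE[OF assms(1)] by metis
  show ?thesis
  proof (cases "\<chi> = \<psi>")
    case True
    have "(\<Sum>g\<in>carrier G. \<chi> g * \<psi> (inv g)) = (\<Sum>i<n. \<Sum>j<n. average \<sigma> \<sigma> (unit_mat n n i j) $$ (i,j))"
      using character_product_as_averages[OF \<sigma>(2) \<sigma>(2)] True \<sigma>(5) by simp
    also have "\<dots> = (\<Sum>i<n. \<Sum>j<n. if i = j then of_nat (card (carrier G)) / of_nat n else 0)"
    proof (intro sum.cong refl)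
      fix i j assume ij: "i \<in> {..<n}" "j \<in> {..<n}"
      obtain c where "average \<sigma> \<sigma> (unit_mat n n i j) = c \<cdot>\<^sub>m 1\<^sub>m n"
        "c * of_nat n = of_nat (card (carrier G)) * mat_trace (unit_mat n n i j)"
        using average_scalar[OF \<sigma>(1) unit_mat_carrier] by metis
      then show "average \<sigma> \<sigma> (unit_mat n n i j) $$ (i,j)
          = (if i = j then of_nat (card (carrier G)) / of_nat n else 0)"
        using ij \<sigma>(3) by (auto simp: mat_trace_unit_mat field_simps)
    qed
    also have "\<dots> = of_nat (card (carrier G))" using \<sigma>(3) by simp
    finally show ?thesis using True by simp
  next
    case False
    obtain m \<rho> where \<rho>: "irreducible_rep G m \<rho>" "\<rho> \<in> hom G (GL m)" "m > 0" "\<psi> = rep_character G \<rho>"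
      "\<And>g. g \<in> carrier G \<Longrightarrow> \<psi> g = mat_trace (\<rho> g)" using IrrE[OF assms(2)] by metis
    have "average \<sigma> \<rho> (unit_mat n m i j) = 0\<^sub>m n m" for i j
    proof (rule ccontr)
      assume ne: "average \<sigma> \<rho> (unit_mat n m i j) \<noteq> 0\<^sub>m n m"
      have "mat_trace (\<rho> g) = mat_trace (\<sigma> g)" if "g \<in> carrier G" for g
        using intertwined_irreducibles_same_trace[OF \<rho>(1) \<sigma>(1) average_carrier[OF unit_mat_carrier] ne _ that]
          average_intertwines[OF \<rho>(2) \<sigma>(2) unit_mat_carrier] by blast
      then have "\<chi> = \<psi>" unfolding \<sigma>(4) \<rho>(4) rep_character_def by auto
      then show False using False by simp
    qed
    then have "(\<Sum>g\<in>carrier G. \<chi> g * \<psi> (inv g)) = 0"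
      using character_product_as_averages[OF \<rho>(2) \<sigma>(2)] \<rho>(5) \<sigma>(5) by simp
    then show ?thesis using False by simp
  qed
qed

text \<open>By Schur's lemma the sum of \<open>\<rho>(x a x\<inverse>)\<close> over all \<open>x\<close> in \<open>G\<close> is the scalar
  \<open>|G| \<chi>(a) / \<chi>(1)\<close>; multiply it by \<open>\<rho> g\<close> and take the trace.\<close>

lemma class_average_multiplicative:
  assumes \<chi>: "\<chi> \<in> Irr G" and a: "a \<in> carrier G" and g: "g \<in> carrier G"
  shows "\<chi> \<one> * (\<Sum>x\<in>carrier G. \<chi> (x \<otimes> a \<otimes> inv x \<otimes> g)) = of_nat (card (carrier G)) * \<chi> a * \<chi> g"
proof -
  obtain n \<rho> where \<rho>: "irreducible_rep G n \<rho>" "\<rho> \<in> hom G (GL n)" "n > 0"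
    "\<And>g. g \<in> carrier G \<Longrightarrow> \<chi> g = mat_trace (\<rho> g)" using IrrE[OF \<chi>] by metis
  note R = rep_carrier[OF \<rho>(2)]
  obtain c where c: "average \<rho> \<rho> (\<rho> a) = c \<cdot>\<^sub>m 1\<^sub>m n" "c * of_nat n = of_nat (card (carrier G)) * mat_trace (\<rho> a)"
    using average_scalar[OF \<rho>(1) R[OF a]] by metis
  have "(\<Sum>x\<in>carrier G. \<chi> (x \<otimes> a \<otimes> inv x \<otimes> g)) = (\<Sum>x\<in>carrier G. mat_trace (\<rho> x * \<rho> a * \<rho> (inv x) * \<rho> g))"
    using a g by (intro sum.cong) (simp_all add: \<rho>(4) rep_mult[OF \<rho>(2)])
  also have "\<dots> = mat_trace (mat_sum n n (\<lambda>x. \<rho> x * \<rho> a * \<rho> (inv x) * \<rho> g) (carrier G))"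
    using mult_carrier_mat[OF sandwich_carrier[OF \<rho>(2) \<rho>(2) R[OF a]] R[OF g]] by (subst mat_trace_sum) auto
  also have "mat_sum n n (\<lambda>x. \<rho> x * \<rho> a * \<rho> (inv x) * \<rho> g) (carrier G) = average \<rho> \<rho> (\<rho> a) * \<rho> g"
    using R[OF a] R[OF g] sandwich_carrier[OF \<rho>(2) \<rho>(2) R[OF a]]
    by (simp add: average_def mat_sum_mult[of "\<rho> g" n n])
  also have "\<dots> = c \<cdot>\<^sub>m \<rho> g" using R[OF g] by (simp add: c(1) mult_smult_assoc_mat[of _ n n _ n])
  also have "mat_trace \<dots> = c * \<chi> g" using R[OF g] by (simp add: mat_trace_smult \<rho>(4)[OF g])
  finally have "(\<Sum>x\<in>carrier G. \<chi> (x \<otimes> a \<otimes> inv x \<otimes> g)) = c * \<chi> g" .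
  moreover have "\<chi> \<one> = of_nat n" using \<rho>(4)[of \<one>] rep_one[OF \<rho>(2)] by (simp add: mat_trace_one)
  ultimately show ?thesis using c(2) \<rho>(4)[OF a] by (simp add: algebra_simps)
qed

end

section \<open>The regular character and second orthogonality\<close>

context finite_group
begin

text \<open>The permutation representation of left multiplication: \<open>g\<close> fixes a basis vector only if
  \<open>g = \<one>\<close>.\<close>

lemma regular_trace:
  obtains n \<rho> where "\<rho> \<in> hom G (GL n)"
    "\<And>g. g \<in> carrier G \<Longrightarrow> mat_trace (\<rho> g) = (if g = \<one> then of_nat (card (carrier G)) else 0)"
proof -
  define n where "n = card (carrier G)"
  obtain e where e: "bij_betw e {..<n} (carrier G)"
    using finite_same_card_bij[of "{..<n}" "carrier G"] finite_carrier by (auto simp: n_def)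
  have e_in: "e i \<in> carrier G" if "i < n" for i using bij_betwE[OF e] that by simp
  have e_inj: "e i = e j \<longleftrightarrow> i = j" if "i < n" "j < n" for i j
    using bij_betw_imp_inj_on[OF e] that by (auto simp: inj_on_def)
  have e_onto: "\<exists>l<n. e l = h" if "h \<in> carrier G" for h
    using bij_betw_imp_surj_on[OF e] that by (metis imageE lessThan_iff)
  define \<rho> where "\<rho> g = mat n n (\<lambda>(i,j). if e i = g \<otimes> e j then 1 else (0::complex))" for g
  have c: "\<rho> g \<in> carrier_mat n n" for g by (simp add: \<rho>_def)
  have "\<rho> \<in> hom G (GL n)"
  proof (rule repI)
    show "\<rho> (g \<otimes> h) = \<rho> g * \<rho> h" if g: "g \<in> carrier G" and h: "h \<in> carrier G" for g h
    proof (rule eq_matI)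
      fix i j assume "i < dim_row (\<rho> g * \<rho> h)" "j < dim_col (\<rho> g * \<rho> h)"
      then have i: "i < n" and j: "j < n" by (auto simp: \<rho>_def)
      obtain k where k: "k < n" "e k = h \<otimes> e j" using e_onto[of "h \<otimes> e j"] h e_in[OF j] by auto
      have "(\<rho> g * \<rho> h) $$ (i,j) = (\<Sum>l<n. if l = k then \<rho> (g \<otimes> h) $$ (i,j) else 0)"
        unfolding mat_mult_index_sum[OF c c i j]
      proof (rule sum.cong)
        fix l assume "l \<in> {..<n}"
        then have l: "l < n" by simp
        have "e l = h \<otimes> e j \<longleftrightarrow> l = k" using e_inj[OF l k(1)] k(2) by simp
        then show "\<rho> g $$ (i,l) * \<rho> h $$ (l,j) = (if l = k then \<rho> (g \<otimes> h) $$ (i,j) else 0)"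
          using i j l k g h e_in[OF j] by (simp add: \<rho>_def m_assoc)
      qed simp
      then show "\<rho> (g \<otimes> h) $$ (i,j) = (\<rho> g * \<rho> h) $$ (i,j)" using k(1) by simp
    qed (auto simp: \<rho>_def)
    show "\<rho> \<one> = 1\<^sub>m n" by (rule eq_matI) (auto simp: \<rho>_def e_in e_inj)
  qed (rule c)
  moreover have "mat_trace (\<rho> g) = (if g = \<one> then of_nat (card (carrier G)) else 0)" if g: "g \<in> carrier G" for g
  proof -
    have "mat_trace (\<rho> g) = (\<Sum>i<n. if g = \<one> then 1 else 0)"
      unfolding mat_trace_def
    proof (rule sum.cong)
      fix i assume "i \<in> {..<n}"
      then have i: "i < n" by simp
      have "e i = g \<otimes> e i \<longleftrightarrow> g = \<one>" using g e_in[OF i] by (metis l_one one_closed r_cancel)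
      then show "\<rho> g $$ (i,i) = (if g = \<one> then 1 else 0)" using i by (simp add: \<rho>_def)
    qed (simp add: \<rho>_def)
    then show ?thesis by (simp add: n_def)
  qed
  ultimately show thesis by (rule that)
qed

text \<open>The regular character is a sum of irreducible characters, and first orthogonality finds the
  multiplicity of \<open>\<chi>\<close> to be \<open>\<chi> \<one>\<close>. As this is never zero, every irreducible character occurs in
  one finite list.\<close>

lemma regular_character:
  shows finite_Irr: "finite (Irr G)"
    and regular_character_sum: "g \<in> carrier G \<Longrightarrow>
      (\<Sum>\<psi>\<in>Irr G. \<psi> \<one> * \<psi> g) = (if g = \<one> then of_nat (card (carrier G)) else 0)"
proof -
  let ?N = "of_nat (card (carrier G)) :: complex"
  obtain n \<rho> where \<rho>: "\<rho> \<in> hom G (GL n)"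
    "\<And>g. g \<in> carrier G \<Longrightarrow> mat_trace (\<rho> g) = (if g = \<one> then ?N else 0)" by (rule regular_trace) blast
  obtain xs where xs: "set xs \<subseteq> Irr G" "\<forall>g\<in>carrier G. mat_trace (\<rho> g) = (\<Sum>\<psi>\<leftarrow>xs. \<psi> g)"
    using rep_trace_sum_of_irreducibles[OF \<rho>(1)] by blast
  have count_sum: "(\<Sum>\<psi>\<leftarrow>xs. f \<psi>) = (\<Sum>\<psi>\<in>set xs. of_nat (count_list xs \<psi>) * f \<psi>)" for f :: "_ \<Rightarrow> complex"
  proof (induction xs)
    case (Cons y ys)
    show ?case
    proof (cases "y \<in> set ys")
      case True
      have "(\<Sum>\<psi>\<in>set (y # ys). of_nat (count_list (y # ys) \<psi>) * f \<psi>)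
          = (\<Sum>\<psi>\<in>set ys. of_nat (count_list ys \<psi>) * f \<psi> + (if \<psi> = y then f \<psi> else 0))"
        using True by (intro sum.cong) (auto simp: algebra_simps)
      then show ?thesis using Cons True by (simp add: sum.distrib)
    next
      case False
      have "(\<Sum>\<psi>\<in>set ys. of_nat (count_list (y # ys) \<psi>) * f \<psi>) = (\<Sum>\<psi>\<in>set ys. of_nat (count_list ys \<psi>) * f \<psi>)"
        using False by (intro sum.cong) auto
      then show ?thesis using Cons False by (simp add: count_notin)
    qed
  qed simp
  have count: "of_nat (count_list xs \<chi>) = \<chi> \<one>" if \<chi>: "\<chi> \<in> Irr G" for \<chi>
  proof -
    have "?N * \<chi> \<one> = (\<Sum>g\<in>carrier G. if g = \<one> then ?N * \<chi> (inv g) else 0)"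
      using finite_carrier by simp
    also have "\<dots> = (\<Sum>g\<in>carrier G. (\<Sum>\<psi>\<leftarrow>xs. \<psi> g) * \<chi> (inv g))"
      using xs(2) \<rho>(2) by (intro sum.cong) auto
    also have "\<dots> = (\<Sum>g\<in>carrier G. \<Sum>\<psi>\<in>set xs. of_nat (count_list xs \<psi>) * (\<psi> g * \<chi> (inv g)))"
      by (simp add: count_sum sum_distrib_right mult.assoc)
    also have "\<dots> = (\<Sum>\<psi>\<in>set xs. of_nat (count_list xs \<psi>) * (\<Sum>g\<in>carrier G. \<psi> g * \<chi> (inv g)))"
      by (subst sum.swap) (simp add: sum_distrib_left)
    also have "\<dots> = (\<Sum>\<psi>\<in>set xs. if \<psi> = \<chi> then of_nat (count_list xs \<chi>) * ?N else 0)"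
      using xs(1) first_orthogonality[OF _ \<chi>] by (intro sum.cong) auto
    also have "\<dots> = of_nat (count_list xs \<chi>) * ?N"
      by (auto simp: count_notin)
    finally show ?thesis using order_pos by simp
  qed
  have Irr: "Irr G = set xs"
  proof (rule antisym[OF _ xs(1)], rule subsetI)
    fix \<chi> assume \<chi>: "\<chi> \<in> Irr G"
    obtain m where "m > 0" "\<chi> \<one> = of_nat m" using degree_pos_nat[OF \<chi>] .
    then show "\<chi> \<in> set xs" using count[OF \<chi>] count_notin[of \<chi> xs] by (metis of_nat_0 of_nat_eq_iff less_irrefl)
  qed
  then show "finite (Irr G)" by simp
  show "(\<Sum>\<psi>\<in>Irr G. \<psi> \<one> * \<psi> g) = (if g = \<one> then ?N else 0)" if g: "g \<in> carrier G"
  proof -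
    have "(\<Sum>\<psi>\<in>Irr G. \<psi> \<one> * \<psi> g) = (\<Sum>\<psi>\<in>set xs. of_nat (count_list xs \<psi>) * \<psi> g)"
      using count Irr by simp
    also have "\<dots> = (if g = \<one> then ?N else 0)"
      using xs(2) \<rho>(2) g count_sum by simp
    finally show ?thesis .
  qed
qed

definition conjugators :: "'a \<Rightarrow> 'a \<Rightarrow> 'a set" where
  "conjugators a g = {x \<in> carrier G. x \<otimes> a \<otimes> inv x = g}"

text \<open>Evaluate the regular character at \<open>x a x\<inverse> g\<inverse>\<close> and sum over \<open>x\<close>: this counts the \<open>x\<close> that
  conjugate \<open>a\<close> to \<open>g\<close>, while the action of the class sum of \<open>a\<close> turns each irreducible
  constituent into a product of character values. The count is \<open>|C\<^sub>G(a)|\<close> when \<open>a\<close> and \<open>g\<close> are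
  conjugate.\<close>

theorem second_orthogonality:
  assumes a: "a \<in> carrier G" and g: "g \<in> carrier G"
  shows "(\<Sum>\<psi>\<in>Irr G. \<psi> a * \<psi> (inv g)) = of_nat (card (conjugators a g))"
proof -
  let ?N = "of_nat (card (carrier G)) :: complex"
  have "?N * (\<Sum>\<psi>\<in>Irr G. \<psi> a * \<psi> (inv g))
      = (\<Sum>\<psi>\<in>Irr G. \<psi> \<one> * (\<Sum>x\<in>carrier G. \<psi> (x \<otimes> a \<otimes> inv x \<otimes> inv g)))"
    using class_average_multiplicative[OF _ a inv_closed[OF g]] by (simp add: sum_distrib_left mult.assoc)
  also have "\<dots> = (\<Sum>x\<in>carrier G. \<Sum>\<psi>\<in>Irr G. \<psi> \<one> * \<psi> (x \<otimes> a \<otimes> inv x \<otimes> inv g))"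
    by (subst sum.swap) (simp add: sum_distrib_left)
  also have "\<dots> = (\<Sum>x\<in>carrier G. if x \<in> conjugators a g then ?N else 0)"
  proof (rule sum.cong)
    fix x assume x: "x \<in> carrier G"
    have "x \<otimes> a \<otimes> inv x \<otimes> inv g = \<one> \<longleftrightarrow> x \<otimes> a \<otimes> inv x = g"
      using a g x by (metis inv_closed inv_solve_right l_one m_closed one_closed)
    then show "(\<Sum>\<psi>\<in>Irr G. \<psi> \<one> * \<psi> (x \<otimes> a \<otimes> inv x \<otimes> inv g)) = (if x \<in> conjugators a g then ?N else 0)"
      using a g x by (subst regular_character_sum) (auto simp: conjugators_def)
  qed simp
  also have "\<dots> = ?N * of_nat (card (conjugators a g))"
  proof -
    have "carrier G \<inter> {x. x \<in> conjugators a g} = conjugators a g" by (auto simp: conjugators_def)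
    then show ?thesis using finite_carrier by (simp add: sum.If_cases mult.commute)
  qed
  finally show ?thesis using order_pos by simp
qed

text \<open>The class algebra constants in terms of characters: up to normalisation, the left side counts
  the ways to write \<open>y\<close> as a product of conjugates of \<open>u\<close> and \<open>v\<close>.\<close>

lemma class_product_count:
  assumes u: "u \<in> carrier G" and v: "v \<in> carrier G" and y: "y \<in> carrier G"
  shows "of_nat (\<Sum>x\<in>carrier G. card (conjugators (x \<otimes> u \<otimes> inv x \<otimes> v) y))
       = of_nat (card (carrier G)) * (\<Sum>\<psi>\<in>Irr G. \<psi> u * \<psi> v * \<psi> (inv y) / \<psi> \<one>)"
proof -
  let ?N = "of_nat (card (carrier G)) :: complex"
  have "of_nat (\<Sum>x\<in>carrier G. card (conjugators (x \<otimes> u \<otimes> inv x \<otimes> v) y))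
      = (\<Sum>x\<in>carrier G. \<Sum>\<psi>\<in>Irr G. \<psi> (x \<otimes> u \<otimes> inv x \<otimes> v) * \<psi> (inv y))"
    using u v y by (simp add: second_orthogonality)
  also have "\<dots> = (\<Sum>\<psi>\<in>Irr G. (\<Sum>x\<in>carrier G. \<psi> (x \<otimes> u \<otimes> inv x \<otimes> v)) * \<psi> (inv y))"
    by (subst sum.swap) (simp add: sum_distrib_right)
  also have "\<dots> = (\<Sum>\<psi>\<in>Irr G. ?N * (\<psi> u * \<psi> v * \<psi> (inv y) / \<psi> \<one>))"
  proof (rule sum.cong)
    fix \<psi> assume \<psi>: "\<psi> \<in> Irr G"
    have "\<psi> \<one> \<noteq> 0" using degree_pos_nat[OF \<psi>] by (metis of_nat_eq_0_iff less_irrefl)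
    then show "(\<Sum>x\<in>carrier G. \<psi> (x \<otimes> u \<otimes> inv x \<otimes> v)) * \<psi> (inv y) = ?N * (\<psi> u * \<psi> v * \<psi> (inv y) / \<psi> \<one>)"
      using class_average_multiplicative[OF \<psi> u v] by (simp add: field_simps)
  qed simp
  finally show ?thesis by (simp add: sum_distrib_left)
qed

lemma character_conj_invariant:
  assumes "\<chi> \<in> Irr G" "a \<in> carrier G" "g \<in> conj_class G a"
  shows "\<chi> g = \<chi> a"
proof -
  obtain n \<rho> where \<rho>: "\<rho> \<in> hom G (GL n)" "\<And>g. g \<in> carrier G \<Longrightarrow> \<chi> g = mat_trace (\<rho> g)"
    by (rule IrrE[OF assms(1)]) blast
  obtain x where x: "x \<in> carrier G" "g = x \<otimes> a \<otimes> inv x" using assms(3) by (auto simp: conj_class_def)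
  have "\<chi> g = mat_trace (\<rho> x * \<rho> a * \<rho> (inv x))"
    using x assms(2) by (simp add: \<rho>(2) rep_mult[OF \<rho>(1)])
  also have "\<dots> = mat_trace (\<rho> a)"
    using rep_carrier[OF \<rho>(1)] rep_inv[OF \<rho>(1) x(1)] x assms(2) by (intro mat_trace_conj[of _ n]) auto
  finally show ?thesis using \<rho>(2) assms(2) by simp
qed

end

section \<open>A normal subgroup with one nontrivial class\<close>

context group
begin

lemma conj_class_carrier: "b \<in> carrier G \<Longrightarrow> conj_class G b \<subseteq> carrier G"
  by (auto simp: conj_class_def)

lemma conj_class_refl: "b \<in> carrier G \<Longrightarrow> b \<in> conj_class G b"
  unfolding conj_class_def by (rule CollectI, rule exI[of _ \<one>]) simp

lemma conj_classI: "x \<in> carrier G \<Longrightarrow> x \<otimes> b \<otimes> inv x \<in> conj_class G b"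
  by (auto simp: conj_class_def)

lemma conj_class_trans:
  assumes b: "b \<in> carrier G" and c: "c \<in> conj_class G b" and d: "d \<in> conj_class G c"
  shows "d \<in> conj_class G b"
proof -
  obtain x y where x: "x \<in> carrier G" "c = x \<otimes> b \<otimes> inv x" and y: "y \<in> carrier G" "d = y \<otimes> c \<otimes> inv y"
    using c d by (auto simp: conj_class_def)
  then have "d = (y \<otimes> x) \<otimes> b \<otimes> inv (y \<otimes> x)" using b by (simp add: inv_mult_group m_assoc)
  then show ?thesis using x(1) y(1) conj_classI by simp
qed

lemma conj_class_sym:
  assumes b: "b \<in> carrier G" and c: "c \<in> conj_class G b"
  shows "b \<in> conj_class G c"
proof -
  obtain x where x: "x \<in> carrier G" "c = x \<otimes> b \<otimes> inv x"
    using c by (auto simp: conj_class_def)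
  then have "b = inv x \<otimes> c \<otimes> inv (inv x)" using b by (simp add: m_assoc inv_solve_left)
  then show ?thesis using x(1) conj_classI[of "inv x" c] by simp
qed

lemma conj_class_one: "conj_class G \<one> = {\<one>}"
  using conj_class_refl[of \<one>] by (auto simp: conj_class_def)

lemma one_notin_conj_class: "b \<in> carrier G \<Longrightarrow> b \<noteq> \<one> \<Longrightarrow> \<one> \<notin> conj_class G b"
  using conj_class_sym[of b \<one>] conj_class_one by auto

lemma conj_mult:
  assumes "g \<in> carrier G" "x \<in> carrier G" "y \<in> carrier G"
  shows "(g \<otimes> x \<otimes> inv g) \<otimes> (g \<otimes> y \<otimes> inv g) = g \<otimes> (x \<otimes> y) \<otimes> inv g"
proof -
  have "inv g \<otimes> (g \<otimes> z) = z" if "z \<in> carrier G" for z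
    using m_assoc[of "inv g" g z] assms(1) that by simp
  then show ?thesis using assms by (simp add: m_assoc)
qed

lemma conj_pow:
  assumes "g \<in> carrier G" "x \<in> carrier G"
  shows "(g \<otimes> x \<otimes> inv g) [^] (k::nat) = g \<otimes> x [^] k \<otimes> inv g"
proof (induction k)
  case (Suc k)
  have "(g \<otimes> x \<otimes> inv g) [^] Suc k = (g \<otimes> x [^] k \<otimes> inv g) \<otimes> (g \<otimes> x \<otimes> inv g)" by (simp add: Suc)
  also have "\<dots> = g \<otimes> x [^] Suc k \<otimes> inv g" using assms conj_mult[of g "x [^] k" x] by simp
  finally show ?case .
qed (use assms in simp)

lemma conj_class_pow_one:
  assumes "b \<in> carrier G" "c \<in> conj_class G b" "b [^] (k::nat) = \<one>"
  shows "c [^] k = \<one>"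
  using assms conj_pow by (auto simp: conj_class_def)

lemma conj_eq_commute:
  assumes "x \<in> carrier G" "y \<in> carrier G"
  shows "x \<otimes> y \<otimes> inv x = y \<longleftrightarrow> x \<otimes> y = y \<otimes> x"
  using assms inv_solve_right[of y "x \<otimes> y" x] by auto

end

text \<open>The class equation. If only \<open>\<one>\<close> were central, every other class would have a size divisible by
  \<open>p\<close>, and so would \<open>p ^ n - 1\<close>.\<close>

lemma (in finite_group) prime_power_order_imp_center:
  assumes p: "Factorial_Ring.prime (p::nat)" and card: "card (carrier G) = p ^ n" and n: "n > 0"
  shows "\<exists>z\<in>carrier G. z \<noteq> \<one> \<and> (\<forall>x\<in>carrier G. x \<otimes> z = z \<otimes> x)"
proof (rule ccontr)
  assume "\<not> ?thesis"
  then have no_center: "\<exists>x\<in>carrier G. x \<otimes> z \<noteq> z \<otimes> x" if "z \<in> carrier G" "z \<noteq> \<one>" for z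
    using that by blast
  define A where "A = carrier G - {\<one>}"
  define r where "r = {(y,z). y \<in> A \<and> z \<in> conj_class G y}"
  have classes: "z \<in> A" if "y \<in> A" "z \<in> conj_class G y" for y z
    using that conj_class_carrier one_notin_conj_class by (auto simp: A_def)
  have "equiv A r"
  proof (rule equivI)
    show "r \<subseteq> A \<times> A" using classes by (auto simp: r_def)
    show "refl_on A r" using conj_class_refl by (auto simp: refl_on_def r_def A_def)
    show "sym r"
    proof (rule symI)
      fix u v assume uv: "(u, v) \<in> r"
      then have "u \<in> carrier G" by (simp add: r_def A_def)
      then show "(v, u) \<in> r" using conj_class_sym[of u v] classes[of u v] uv by (simp add: r_def)
    qed
    show "trans r"
    proof (rule transI)
      fix u v w assume uv: "(u, v) \<in> r" and vw: "(v, w) \<in> r"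
      then have "u \<in> carrier G" by (simp add: r_def A_def)
      then show "(u, w) \<in> r" using conj_class_trans[of u v w] uv vw by (simp add: r_def)
    qed
  qed
  moreover have "p dvd card K" if "K \<in> A // r" for K
  proof -
    obtain y where y: "y \<in> A" "K = conj_class G y"
      using \<open>K \<in> A // r\<close> by (auto simp: quotient_def r_def)
    interpret act: group_action G "carrier G" "\<lambda>g. \<lambda>h\<in>carrier G. g \<otimes> h \<otimes> inv g"
      by (rule action_by_conjugation)
    have "Group_Action.orbit G (\<lambda>g. \<lambda>h\<in>carrier G. g \<otimes> h \<otimes> inv g) y = K"
      using y by (auto simp: Group_Action.orbit_def conj_class_def A_def)
    then have "card K * card (stabilizer G (\<lambda>g. \<lambda>h\<in>carrier G. g \<otimes> h \<otimes> inv g) y) = p ^ n"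
      using act.orbit_stabilizer_theorem[of y] y(1) card by (simp add: A_def Coset.order_def)
    then have "card K dvd p ^ n" by (rule dvdI[OF sym])
    then obtain k where k: "card K = p ^ k" using divides_primepow_nat[OF p, of "card K" n] by auto
    have "k \<noteq> 0"
    proof
      assume "k = 0"
      then have K: "K = {y}" using k y conj_class_refl[of y] by (auto simp: A_def card_1_singleton_iff)
      have "x \<otimes> y = y \<otimes> x" if "x \<in> carrier G" for x
        using conj_classI[OF that, of y] conj_eq_commute[OF that, of y] K y by (auto simp: A_def)
      then show False using no_center[of y] y by (auto simp: A_def)
    qed
    then show "p dvd card K" using k by simp
  qed
  ultimately have "p dvd card A" using finite_carrier equiv_imp_dvd_card[of A r p] by (simp add: A_def)
  moreover have "card (carrier G) = card A + 1"
    using finite_carrier order_pos by (simp add: A_def card_Diff_singleton)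
  moreover have "p dvd card (carrier G)" using card n by simp
  ultimately have "p dvd 1" using dvd_add_right_iff[of p "card A" 1] by simp
  then show False using p by (simp add: prime_nat_iff)
qed

text \<open>Another prime divisor \<open>q\<close> of the order would give, by Sylow, a subgroup of order \<open>q\<close>, whose
  nontrivial elements have order dividing both \<open>p\<close> and \<open>q\<close>.\<close>

lemma (in finite_group) prime_exponent_imp_prime_power_order:
  assumes p: "Factorial_Ring.prime (p::nat)" and ex: "\<And>x. x \<in> carrier G \<Longrightarrow> x [^] p = \<one>"
  obtains n where "card (carrier G) = p ^ n"
proof -
  have only_p: "q = p" if q: "Factorial_Ring.prime q" and dvd: "q dvd card (carrier G)" for q :: nat
  proof -
    obtain m where "card (carrier G) = q ^ 1 * m" using dvd by auto
    then obtain H where H: "subgroup H G" "card H = q ^ 1"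
      using sylow_thm[OF q is_group, of 1 m] finite_carrier by (auto simp: Coset.order_def)
    have "H \<noteq> {\<one>}" using H(2) q by (auto simp: prime_nat_iff)
    then obtain x where x: "x \<in> H" "x \<noteq> \<one>" using subgroup.one_closed[OF H(1)] by auto
    have xG: "x \<in> carrier G" using subgroup.mem_carrier[OF H(1) x(1)] .
    interpret H: group "G\<lparr>carrier := H\<rparr>" using subgroup_imp_group[OF H(1)] .
    have "x [^] card H = \<one>"
      using H.pow_order_eq_1[of x] x(1) nat_pow_consistent[of x "card H" H] by (simp add: Coset.order_def)
    then have "group.ord G x dvd q" using pow_eq_id[OF xG] H(2) by simp
    moreover have "group.ord G x dvd p" using pow_eq_id[OF xG] ex[OF xG] by simp
    moreover have "group.ord G x \<noteq> 1" using ord_eq_1[OF xG] x(2) by simp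
    ultimately show "q = p" using p q by (metis prime_nat_iff)
  qed
  have ne0: "card (carrier G) \<noteq> 0" using order_pos by simp
  obtain m where m: "card (carrier G) = p ^ multiplicity p (card (carrier G)) * m" "\<not> p dvd m"
    using multiplicity_decompose'[OF ne0] p by (metis not_prime_unit)
  have "m = 1"
  proof (rule ccontr)
    assume "m \<noteq> 1"
    then obtain q where q: "Factorial_Ring.prime q" "q dvd m" using prime_factor_nat by blast
    then have "q = p" using only_p[of q] m(1) by (metis dvd_mult)
    then show False using q m(2) by simp
  qed
  then show thesis using that m(1) by simp
qed

text \<open>All nontrivial elements of \<open>N\<close> are conjugate in \<open>G\<close>, so any property that is preserved by
  conjugation and holds for one of them holds for all. This is applied to lying in a smaller
  normal subgroup, to having prime order, and to being central in the \<open>p\<close>-group \<open>N\<close>.\<close>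

theorem (in finite_group) single_class_normal_subgroup:
  assumes b: "b \<in> carrier G" "b \<noteq> \<one>" and N: "N \<lhd> G" and Nb: "N = {\<one>} \<union> conj_class G b"
  shows "minimal_normal_subgroup G N"
    and "card N = 1 + card (conj_class G b)"
    and "\<exists>p n. Factorial_Ring.prime p \<and> n > 0 \<and> group.ord G b = p \<and> card N = p ^ n \<and>
           elementary_abelian p (G\<lparr>carrier := N\<rparr>)"
proof -
  have subN: "subgroup N G" using N by (rule normal_imp_subgroup)
  have NG: "N \<subseteq> carrier G" by (rule subgroup.subset[OF subN])
  have finN: "finite N" using NG finite_carrier finite_subset by auto
  have bN: "b \<in> N" using Nb conj_class_refl[OF b(1)] by simp
  have all_conj: "y \<in> conj_class G x" if "x \<in> N" "x \<noteq> \<one>" "y \<in> N" "y \<noteq> \<one>" for x y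
    using that Nb conj_class_sym[OF b(1), of x] conj_class_trans[of x b y] NG by auto
  have conj_N: "x \<otimes> h \<otimes> inv x \<in> N" if "x \<in> carrier G" "h \<in> N" for x h
    using N that by (simp add: normal_inv_iff)
  show "minimal_normal_subgroup G N"
    unfolding minimal_normal_subgroup_def
  proof (intro conjI allI impI)
    show "N \<noteq> {\<one>}" using bN b(2) by auto
    fix M assume M: "M \<lhd> G \<and> M \<subseteq> N"
    have M1: "\<one> \<in> M" using M subgroup.one_closed normal_imp_subgroup by blast
    show "M = {\<one>} \<or> M = N"
    proof (cases "M = {\<one>}")
      case False
      then obtain m where m: "m \<in> M" "m \<noteq> \<one>" using M1 by auto
      have "y \<in> M" if y: "y \<in> N" for y
      proof (cases "y = \<one>")
        case False
        then have "y \<in> conj_class G m" using all_conj[of m y] m M y by auto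
        then show ?thesis using M m(1) by (auto simp: conj_class_def normal_inv_iff)
      qed (use M1 in simp)
      then show ?thesis using M by auto
    qed simp
  qed (rule N)
  show "card N = 1 + card (conj_class G b)"
    using Nb finN one_notin_conj_class[OF b] by simp
  interpret N: finite_group "G\<lparr>carrier := N\<rparr>"
    using subgroup_imp_group[OF subN] finN by (simp add: finite_group_def finite_group_axioms_def)
  have "group.ord G b \<noteq> 1" using ord_eq_1[OF b(1)] b(2) by simp
  then obtain p where p: "Factorial_Ring.prime p" "p dvd group.ord G b" using prime_factor_nat by blast
  obtain d where d: "group.ord G b = p * d" using p(2) by auto
  have ord_pos: "group.ord G b > 0" using ord_ge_1[OF finite_carrier b(1)] by simp
  \<comment> \<open>a power of \<open>b\<close> has order \<open>p\<close>, and it is conjugate to \<open>b\<close>\<close>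
  have bp: "b [^] p = \<one>"
  proof -
    have bd: "b [^] d \<in> N" using N.nat_pow_closed[of b d] bN by (simp add: nat_pow_consistent[symmetric])
    have "b [^] d \<noteq> \<one>"
    proof
      assume "b [^] d = \<one>"
      then have "p * d dvd d" using pow_eq_id[OF b(1)] d by simp
      then show False using d ord_pos p(1) by (auto simp: prime_nat_iff dest: dvd_imp_le)
    qed
    moreover have "(b [^] d) [^] p = \<one>"
      using b(1) pow_ord_eq_1[OF b(1)] d by (simp add: nat_pow_pow mult.commute)
    ultimately show ?thesis
      using conj_class_pow_one[OF _ all_conj[OF bd _ bN b(2)], of p] b(1) by simp
  qed
  then have "group.ord G b dvd p" using pow_eq_id[OF b(1)] by simp
  then have ordb: "group.ord G b = p" using p by (simp add: dvd_antisym)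
  have expN: "x [^] p = \<one>" if "x \<in> N" for x
    using that Nb bp conj_class_pow_one[OF b(1)] by auto
  obtain n where n: "card N = p ^ n"
    using N.prime_exponent_imp_prime_power_order[OF p(1)] expN
    by (auto simp: nat_pow_consistent[symmetric])
  have n0: "n > 0"
  proof (rule ccontr)
    assume "\<not> n > 0"
    then have "card N = 1" using n by simp
    then show False using bN b(2) subgroup.one_closed[OF subN] by (auto simp: card_1_singleton_iff)
  qed
  obtain z where z: "z \<in> N" "z \<noteq> \<one>" "\<And>x. x \<in> N \<Longrightarrow> x \<otimes> z = z \<otimes> x"
    using N.prime_power_order_imp_center[OF p(1) _ n0] n by auto
  have comm: "x \<otimes> y = y \<otimes> x" if x: "x \<in> N" and y: "y \<in> N" for x y
  proof (cases "y = \<one>")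
    case False
    then obtain g where g: "g \<in> carrier G" "y = g \<otimes> z \<otimes> inv g"
      using all_conj[OF z(1,2) y] by (auto simp: conj_class_def)
    have zG: "z \<in> carrier G" and xG: "x \<in> carrier G" using z(1) x NG by auto
    \<comment> \<open>conjugating by \<open>g\<close> reduces commuting with \<open>y\<close> to commuting with the central element \<open>z\<close>\<close>
    define w where "w = inv g \<otimes> x \<otimes> g"
    have "w \<in> N" using conj_N[of "inv g" x] g(1) x by (simp add: w_def)
    then have wz: "w \<otimes> z = z \<otimes> w" by (rule z(3))
    have wG: "w \<in> carrier G" using g(1) xG by (simp add: w_def)
    have "x = g \<otimes> w \<otimes> inv g" using g(1) xG m_assoc[of g "inv g" x] by (simp add: w_def m_assoc)
    moreover have "(g \<otimes> w \<otimes> inv g) \<otimes> (g \<otimes> z \<otimes> inv g) = g \<otimes> (w \<otimes> z) \<otimes> inv g"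
      by (rule conj_mult[OF g(1)]) fact+
    moreover have "(g \<otimes> z \<otimes> inv g) \<otimes> (g \<otimes> w \<otimes> inv g) = g \<otimes> (z \<otimes> w) \<otimes> inv g"
      by (rule conj_mult[OF g(1)]) fact+
    ultimately show ?thesis using wz g(2) by simp
  qed (use x NG in auto)
  have "elementary_abelian p (G\<lparr>carrier := N\<rparr>)"
    unfolding elementary_abelian_def
    using p(1) finN expN N.group_comm_groupI comm by (auto simp: nat_pow_consistent[symmetric])
  then show "\<exists>p n. Factorial_Ring.prime p \<and> n > 0 \<and> group.ord G b = p \<and> card N = p ^ n \<and>
           elementary_abelian p (G\<lparr>carrier := N\<rparr>)"
    using p(1) n0 ordb n by auto
qed

section \<open>Two columns that differ once\<close>

context finite_group
begin

lemma card_conjugators_eq_0_iff: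
  assumes "a \<in> carrier G"
  shows "card (conjugators a g) = 0 \<longleftrightarrow> g \<notin> conj_class G a"
proof -
  have "finite (conjugators a g)" using finite_carrier by (simp add: conjugators_def)
  then show ?thesis by (auto simp: conjugators_def conj_class_def)
qed

lemma card_conjugators_one: "card (conjugators \<one> g) = (if g = \<one> then card (carrier G) else 0)"
proof -
  have "conjugators \<one> g = (if g = \<one> then carrier G else {})" by (auto simp: conjugators_def)
  then show ?thesis by simp
qed

text \<open>Subtracting the orthogonality relations of the columns of \<open>a\<close> and \<open>b\<close> against the column of
  \<open>g\<close> leaves the single term of \<open>\<chi>\<close>. For nonconjugate \<open>a\<close> and \<open>b\<close> this determines where \<open>\<chi>\<close>
  vanishes.\<close>

lemma columns_differ_once_identity:
  assumes a: "a \<in> carrier G" and b: "b \<in> carrier G" and \<chi>: "\<chi> \<in> Irr G"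
    and same: "\<And>\<psi>. \<psi> \<in> Irr G \<Longrightarrow> \<psi> \<noteq> \<chi> \<Longrightarrow> \<psi> a = \<psi> b" and g: "g \<in> carrier G"
  shows "(\<chi> a - \<chi> b) * \<chi> (inv g) = of_nat (card (conjugators a g)) - of_nat (card (conjugators b g))"
proof -
  have "of_nat (card (conjugators a g)) - of_nat (card (conjugators b g))
      = (\<Sum>\<psi>\<in>Irr G. (\<psi> a - \<psi> b) * \<psi> (inv g))"
    using second_orthogonality[OF a g] second_orthogonality[OF b g]
    by (simp add: sum_subtractf left_diff_distrib)
  also have "\<dots> = (\<Sum>\<psi>\<in>Irr G. if \<psi> = \<chi> then (\<chi> a - \<chi> b) * \<chi> (inv g) else 0)"
    using same by (intro sum.cong) auto
  also have "\<dots> = (\<chi> a - \<chi> b) * \<chi> (inv g)" using finite_Irr \<chi> by simp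
  finally show ?thesis by simp
qed

lemma degree_nonzero: "\<chi> \<in> Irr G \<Longrightarrow> \<chi> \<one> \<noteq> 0"
  using degree_pos_nat[of \<chi>] by (metis of_nat_eq_0_iff less_irrefl)

text \<open>The character \<open>\<chi>\<close> vanishes off the classes of \<open>a\<close> and \<open>b\<close>, but not at \<open>\<one>\<close>.\<close>

lemma columns_differ_once_imp_one:
  assumes a: "a \<in> carrier G" and b: "b \<in> carrier G" and \<chi>: "\<chi> \<in> Irr G" and ne: "\<chi> a \<noteq> \<chi> b"
    and same: "\<And>\<psi>. \<psi> \<in> Irr G \<Longrightarrow> \<psi> \<noteq> \<chi> \<Longrightarrow> \<psi> a = \<psi> b"
  shows "a = \<one> \<or> b = \<one>"
proof (rule ccontr)
  assume "\<not> (a = \<one> \<or> b = \<one>)"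
  then have "card (conjugators a \<one>) = 0" "card (conjugators b \<one>) = 0"
    using one_notin_conj_class a b card_conjugators_eq_0_iff by auto
  then have "(\<chi> a - \<chi> b) * \<chi> (inv \<one>) = 0"
    using columns_differ_once_identity[OF a b \<chi> same one_closed] by simp
  then show False using ne degree_nonzero[OF \<chi>] by simp
qed

end

text \<open>The situation after one of the two columns has been recognised as that of \<open>\<one>\<close>. The last
  assumption holds in every finite group; an enumeration of \<open>Irr G\<close> supplies it.\<close>

locale cd1_columns = finite_group +
  fixes b :: 'a and \<chi> :: "'a \<Rightarrow> complex"
  assumes b_closed: "b \<in> carrier G" and b_ne_one: "b \<noteq> \<one>"
    and \<chi>_Irr: "\<chi> \<in> Irr G" and \<chi>_differs: "\<chi> \<one> \<noteq> \<chi> b"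
    and others_agree: "\<psi> \<in> Irr G \<Longrightarrow> \<psi> \<noteq> \<chi> \<Longrightarrow> \<psi> \<one> = \<psi> b"
    and principal_Irr: "principal_char G \<in> Irr G"
begin

definition K :: "'a set" where "K = {\<one>} \<union> conj_class G b"

lemma K_carrier: "K \<subseteq> carrier G"
  using conj_class_carrier[OF b_closed] by (auto simp: K_def)

lemma one_in_K: "\<one> \<in> K"
  by (simp add: K_def)

lemma card_K: "card K = 1 + card (conj_class G b)"
proof -
  have "finite (conj_class G b)" using conj_class_carrier[OF b_closed] finite_carrier finite_subset by auto
  then show ?thesis using one_notin_conj_class[OF b_closed b_ne_one] by (simp add: K_def)
qed

lemma class_pos: "card (conj_class G b) > 0"
  using conj_class_refl[OF b_closed] conj_class_carrier[OF b_closed] finite_carrier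
  by (metis card_gt_0_iff empty_iff finite_subset)

lemma column_identity:
  "g \<in> carrier G \<Longrightarrow> (\<chi> \<one> - \<chi> b) * \<chi> (inv g)
     = (if g = \<one> then of_nat (card (carrier G)) else 0) - of_nat (card (conjugators b g))"
  using columns_differ_once_identity[OF one_closed b_closed \<chi>_Irr others_agree]
  by (simp add: card_conjugators_one)

lemma \<chi>_support:
  assumes g: "g \<in> carrier G"
  shows "\<chi> (inv g) \<noteq> 0 \<longleftrightarrow> g \<in> K"
proof (cases "g = \<one>")
  case True
  then show ?thesis using degree_nonzero[OF \<chi>_Irr] by (simp add: K_def)
next
  case False
  then have "\<chi> (inv g) = 0 \<longleftrightarrow> card (conjugators b g) = 0"
    using column_identity[OF g] \<chi>_differs by auto
  then show ?thesis using card_conjugators_eq_0_iff[OF b_closed] False by (auto simp: K_def)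
qed

lemma others_on_K:
  assumes "\<psi> \<in> Irr G" "\<psi> \<noteq> \<chi>" "g \<in> K"
  shows "\<psi> g = \<psi> \<one>"
  using assms others_agree[of \<psi>] character_conj_invariant[OF assms(1) b_closed, of g] by (auto simp: K_def)

text \<open>If all characters other than \<open>\<chi>\<close> agree at \<open>\<one>\<close> and \<open>g \<noteq> \<one>\<close>, then the columns of \<open>\<one>\<close> and \<open>g\<close>
  also differ once, so \<open>\<chi>\<close> is nonzero at \<open>inv g\<close>; but the support of \<open>\<chi>\<close> is known from \<open>b\<close>.\<close>

lemma K_is_intersection_of_kernels:
  "K = {g \<in> carrier G. \<forall>\<psi>\<in>Irr G. \<psi> \<noteq> \<chi> \<longrightarrow> \<psi> g = \<psi> \<one>}"
proof (intro equalityI subsetI)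
  fix g assume "g \<in> {g \<in> carrier G. \<forall>\<psi>\<in>Irr G. \<psi> \<noteq> \<chi> \<longrightarrow> \<psi> g = \<psi> \<one>}"
  then have g: "g \<in> carrier G" and eq: "\<And>\<psi>. \<psi> \<in> Irr G \<Longrightarrow> \<psi> \<noteq> \<chi> \<Longrightarrow> \<psi> \<one> = \<psi> g" by auto
  show "g \<in> K"
  proof (cases "g = \<one>")
    case False
    have "(\<chi> \<one> - \<chi> g) * \<chi> (inv g) = - of_nat (card (conjugators g g))"
      using columns_differ_once_identity[OF one_closed g \<chi>_Irr eq g] False by (simp add: card_conjugators_one)
    moreover have "card (conjugators g g) \<noteq> 0"
      using card_conjugators_eq_0_iff[OF g, of g] conj_class_refl[OF g] by simp
    ultimately have "\<chi> (inv g) \<noteq> 0" by auto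
    then show ?thesis using \<chi>_support[OF g] by simp
  qed (simp add: one_in_K)
qed (use others_on_K K_carrier in auto)

text \<open>That a character kernel is a subgroup is usually seen from eigenvalues. Here class algebra
  constants suffice: for \<open>y\<close> outside \<open>K\<close> the term of \<open>\<chi>\<close> vanishes, and the other characters take
  their degree at \<open>u\<close> and \<open>v\<close>, so the number of ways to write \<open>y\<close> as a product of conjugates of
  \<open>u\<close> and \<open>v\<close> is a multiple of the inner product of the columns of \<open>\<one>\<close> and \<open>y\<close>, which is \<open>0\<close>.\<close>

lemma K_mult_closed:
  assumes u: "u \<in> K" and v: "v \<in> K"
  shows "u \<otimes> v \<in> K"
proof (rule ccontr)
  define y where "y = u \<otimes> v"
  assume "u \<otimes> v \<notin> K"
  then have yK: "y \<notin> K" by (simp add: y_def)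
  have uG: "u \<in> carrier G" and vG: "v \<in> carrier G" using u v K_carrier by auto
  then have yG: "y \<in> carrier G" by (simp add: y_def)
  have "\<chi> (inv y) = 0" using \<chi>_support[OF yG] yK by simp
  then have "(\<Sum>\<psi>\<in>Irr G. \<psi> u * \<psi> v * \<psi> (inv y) / \<psi> \<one>) = (\<Sum>\<psi>\<in>Irr G. \<psi> \<one> * \<psi> (inv y))"
  proof (intro sum.cong refl)
    fix \<psi> assume "\<psi> \<in> Irr G"
    then show "\<psi> u * \<psi> v * \<psi> (inv y) / \<psi> \<one> = \<psi> \<one> * \<psi> (inv y)"
      using \<open>\<chi> (inv y) = 0\<close> others_on_K[of \<psi> u] others_on_K[of \<psi> v] u v degree_nonzero[of \<psi>]
      by (cases "\<psi> = \<chi>") auto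
  qed
  also have "\<dots> = 0"
    using second_orthogonality[OF one_closed yG] yK one_in_K by (auto simp: card_conjugators_one)
  finally have "of_nat (\<Sum>x\<in>carrier G. card (conjugators (x \<otimes> u \<otimes> inv x \<otimes> v) y)) = (0::complex)"
    using class_product_count[OF uG vG yG] by simp
  then have "(\<Sum>x\<in>carrier G. card (conjugators (x \<otimes> u \<otimes> inv x \<otimes> v) y)) = 0"
    by (simp only: of_nat_eq_0_iff)
  then have "card (conjugators (\<one> \<otimes> u \<otimes> inv \<one> \<otimes> v) y) = 0"
    using finite_carrier one_closed by (meson sum_eq_0_iff)
  then show False
    using uG vG yG card_conjugators_eq_0_iff[OF yG, of y] conj_class_refl[OF yG] by (simp add: y_def)
qed

lemma K_normal: "K \<lhd> G"
proof (rule normal_invI)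
  show "subgroup K G"
  proof (rule subgroupI)
    show "inv u \<in> K" if u: "u \<in> K" for u
    proof -
      have uG: "u \<in> carrier G" using u K_carrier by auto
      have pow: "u [^] (n::nat) \<in> K" for n
        by (induction n) (use one_in_K K_mult_closed u in auto)
      have "u [^] (card (carrier G) - 1) \<otimes> u = \<one>"
        using pow_order_eq_1[OF uG] order_pos
        by (metis Coset.order_def Suc_diff_1 nat_pow_Suc)
      then have "inv u = u [^] (card (carrier G) - 1)"
        using uG by (intro inv_equality) auto
      then show ?thesis using pow by simp
    qed
  qed (use K_carrier one_in_K K_mult_closed in auto)
  show "x \<otimes> h \<otimes> inv x \<in> K" if x: "x \<in> carrier G" and h: "h \<in> K" for x h
    using conj_class_trans[OF b_closed, of h] conj_classI[OF x, of h] h x by (auto simp: K_def)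
qed

lemma \<chi>_not_principal: "\<chi> \<noteq> principal_char G"
  using \<chi>_differs b_closed by (auto simp: principal_char_def)

text \<open>Orthogonality of \<open>\<chi>\<close> to the principal character gives \<open>\<chi>(1) + |b\<^sup>G| \<chi>(b) = 0\<close>, since \<open>\<chi>\<close>
  is supported on \<open>K\<close>; and the column identity at \<open>\<one>\<close> reads \<open>(\<chi>(1) - \<chi>(b)) \<chi>(1) = |G|\<close>.
  Eliminate \<open>\<chi>(b)\<close>.\<close>

lemma \<chi>_degree:
  "\<chi> \<one> ^ 2 * of_nat (card (conj_class G b) + 1) = of_nat (card (carrier G) * card (conj_class G b))"
proof -
  let ?c = "of_nat (card (conj_class G b)) :: complex"
  have "(\<Sum>g\<in>carrier G. \<chi> (inv g)) = (\<Sum>g\<in>carrier G. principal_char G g * \<chi> (inv g))"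
    by (intro sum.cong) (auto simp: principal_char_def)
  also have "\<dots> = 0"
    using first_orthogonality[OF principal_Irr \<chi>_Irr] \<chi>_not_principal by simp
  finally have "0 = (\<Sum>g\<in>carrier G. \<chi> (inv g))" by simp
  also have "\<dots> = (\<Sum>g\<in>K. \<chi> (inv g))"
    using \<chi>_support K_carrier finite_carrier by (intro sum.mono_neutral_right) auto
  also have "\<dots> = \<chi> \<one> + (\<Sum>g\<in>conj_class G b. \<chi> (inv g))"
    unfolding K_def using one_notin_conj_class[OF b_closed b_ne_one] conj_class_carrier[OF b_closed]
      finite_subset[OF _ finite_carrier] by (subst sum.union_disjoint) auto
  also have "(\<Sum>g\<in>conj_class G b. \<chi> (inv g)) = (\<Sum>g\<in>conj_class G b. \<chi> b)"
  proof (intro sum.cong refl)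
    fix g assume g: "g \<in> conj_class G b"
    have gK: "g \<in> K" and gG: "g \<in> carrier G" and "g \<noteq> \<one>"
      using g conj_class_carrier[OF b_closed] one_notin_conj_class[OF b_closed b_ne_one] by (auto simp: K_def)
    then have "inv g \<noteq> \<one>" by simp
    moreover have "inv g \<in> K"
      using subgroup.m_inv_closed[OF normal_imp_subgroup[OF K_normal] gK] .
    ultimately have "inv g \<in> conj_class G b" by (simp add: K_def)
    then show "\<chi> (inv g) = \<chi> b" by (rule character_conj_invariant[OF \<chi>_Irr b_closed])
  qed
  finally have sum0: "?c * \<chi> b = - \<chi> \<one>" by (simp add: add_eq_0_iff2)
  have "card (conjugators b \<one>) = 0"
    using card_conjugators_eq_0_iff[OF b_closed] one_notin_conj_class[OF b_closed b_ne_one] by simp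
  then have id: "(\<chi> \<one> - \<chi> b) * \<chi> \<one> = of_nat (card (carrier G))"
    using column_identity[OF one_closed] by simp
  have "of_nat (card (carrier G)) * ?c = ?c * \<chi> \<one> * \<chi> \<one> - (?c * \<chi> b) * \<chi> \<one>"
    unfolding id[symmetric] by (simp add: algebra_simps)
  also have "\<dots> = \<chi> \<one> ^ 2 * of_nat (card (conj_class G b) + 1)"
    unfolding sum0 by (simp add: algebra_simps power2_eq_square)
  finally show ?thesis by simp
qed

lemma degree_real: "\<psi> \<in> Irr G \<Longrightarrow> \<psi> \<one> = of_real (Re (\<psi> \<one>)) \<and> Re (\<psi> \<one>) > 0"
  by (erule degree_pos_nat) simp

text \<open>By the degree formula the squared degrees of the characters other than \<open>\<chi>\<close> sum to
  \<open>|G| / |K|\<close>, and this is at most \<open>\<chi>(1)\<^sup>2\<close>. The principal character contributes \<open>1\<close> to that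
  sum, which makes the inequality for \<open>\<psi>\<close> strict; the strictness identifies \<open>\<chi>\<close> as the last
  character whatever order is chosen among characters of equal degree.\<close>

lemma \<chi>_degree_dominates:
  assumes \<psi>: "\<psi> \<in> Irr G" "\<psi> \<noteq> \<chi>" "\<psi> \<noteq> principal_char G"
  shows "Re (\<psi> \<one>) < Re (\<chi> \<one>)"
proof -
  define d where "d \<phi> = Re (\<phi> \<one>)" for \<phi> :: "'a \<Rightarrow> complex"
  define c where "c = real (card (conj_class G b))"
  define N where "N = real (card (carrier G))"
  have d: "\<phi> \<one> = of_real (d \<phi>)" if "\<phi> \<in> Irr G" for \<phi> using degree_real[OF that] by (simp add: d_def)
  have c1: "c \<ge> 1" using class_pos by (simp add: c_def)
  have "complex_of_real (d \<chi> ^ 2 * (c + 1)) = of_real (N * c)"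
    using \<chi>_degree unfolding d[OF \<chi>_Irr] by (simp add: c_def N_def add.commute)
  then have \<chi>d: "d \<chi> ^ 2 * (c + 1) = N * c" by (simp only: of_real_eq_iff)
  have "complex_of_real (\<Sum>\<phi>\<in>Irr G. d \<phi> ^ 2) = (\<Sum>\<phi>\<in>Irr G. \<phi> \<one> * \<phi> (inv \<one>))"
    unfolding of_real_sum by (intro sum.cong refl) (simp add: d power2_eq_square)
  also have "\<dots> = of_real N"
    using second_orthogonality[OF one_closed one_closed] by (simp add: card_conjugators_one N_def)
  finally have "(\<Sum>\<phi>\<in>Irr G. d \<phi> ^ 2) = N" by (simp only: of_real_eq_iff)
  then have rest: "(\<Sum>\<phi>\<in>Irr G - {\<chi>}. d \<phi> ^ 2) = N - d \<chi> ^ 2"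
    using finite_Irr \<chi>_Irr by (simp add: sum_diff1)
  have "(\<Sum>\<phi>\<in>{principal_char G, \<psi>}. d \<phi> ^ 2) \<le> (\<Sum>\<phi>\<in>Irr G - {\<chi>}. d \<phi> ^ 2)"
    using finite_Irr principal_Irr \<chi>_not_principal \<psi> by (intro sum_mono2) auto
  then have "1 + d \<psi> ^ 2 \<le> N - d \<chi> ^ 2"
    using \<psi>(3) rest by (simp add: d_def principal_char_def)
  moreover have "N - d \<chi> ^ 2 \<le> d \<chi> ^ 2"
  proof -
    have "(N - d \<chi> ^ 2) * (c + 1) = N" using \<chi>d by (simp add: algebra_simps)
    also have "\<dots> \<le> N * c" using c1 by (simp add: N_def mult_le_cancel_left1)
    finally have "(N - d \<chi> ^ 2) * (c + 1) \<le> d \<chi> ^ 2 * (c + 1)" using \<chi>d by simp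
    then show ?thesis using c1 by simp
  qed
  ultimately have "d \<psi> ^ 2 < d \<chi> ^ 2" by simp
  moreover have "d \<chi> > 0" using degree_real[OF \<chi>_Irr] by (simp add: d_def)
  ultimately show ?thesis using power2_less_imp_less[of "d \<psi>" "d \<chi>"] by (simp add: d_def)
qed

text \<open>For \<open>g\<close> outside \<open>K\<close>, the class algebra constant of \<open>u\<close>, \<open>g\<close> and \<open>g\<close> is the same as with \<open>\<one>\<close> in
  place of \<open>u\<close>, term by term, and hence positive. So \<open>g\<close> is conjugate to \<open>w g\<close> for some
  conjugate \<open>w\<close> of \<open>u\<close>. Then \<open>w\<close> is a commutator, and \<open>u\<close> lies in the commutator subgroup
  because that is normal.\<close>

lemma K_subset_derived:
  assumes "K \<noteq> carrier G"
  shows "K \<subseteq> derived G (carrier G)"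
proof
  fix u assume u: "u \<in> K"
  have uG: "u \<in> carrier G" using u K_carrier by auto
  obtain g where g: "g \<in> carrier G" "g \<notin> K" using assms K_carrier by auto
  have "\<chi> (inv g) = 0" using \<chi>_support[OF g(1)] g(2) by simp
  then have "(\<Sum>\<psi>\<in>Irr G. \<psi> u * \<psi> g * \<psi> (inv g) / \<psi> \<one>) = (\<Sum>\<psi>\<in>Irr G. \<psi> g * \<psi> (inv g))"
  proof (intro sum.cong refl)
    fix \<psi> assume "\<psi> \<in> Irr G"
    then show "\<psi> u * \<psi> g * \<psi> (inv g) / \<psi> \<one> = \<psi> g * \<psi> (inv g)"
      using \<open>\<chi> (inv g) = 0\<close> others_on_K[of \<psi> u] u degree_nonzero[of \<psi>]
      by (cases "\<psi> = \<chi>") auto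
  qed
  also have "\<dots> = of_nat (card (conjugators g g))" by (rule second_orthogonality[OF g(1) g(1)])
  finally have "of_nat (\<Sum>x\<in>carrier G. card (conjugators (x \<otimes> u \<otimes> inv x \<otimes> g) g))
      = (of_nat (card (carrier G) * card (conjugators g g)) :: complex)"
    using class_product_count[OF uG g(1) g(1)] by simp
  then have "(\<Sum>x\<in>carrier G. card (conjugators (x \<otimes> u \<otimes> inv x \<otimes> g) g)) = card (carrier G) * card (conjugators g g)"
    by (simp only: of_nat_eq_iff)
  also have "\<dots> \<noteq> 0"
    using order_pos card_conjugators_eq_0_iff[OF g(1), of g] conj_class_refl[OF g(1)] by simp
  finally obtain x where x: "x \<in> carrier G" "card (conjugators (x \<otimes> u \<otimes> inv x \<otimes> g) g) \<noteq> 0"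
    by (meson sum.neutral)
  define w where "w = x \<otimes> u \<otimes> inv x"
  have wG: "w \<in> carrier G" using x(1) uG by (simp add: w_def)
  have "g \<in> conj_class G (w \<otimes> g)"
    using x(2) card_conjugators_eq_0_iff[of "w \<otimes> g" g] wG g(1) by (simp add: w_def)
  then have "w \<otimes> g \<in> conj_class G g" using conj_class_sym[of "w \<otimes> g" g] wG g(1) by simp
  then obtain y where y: "y \<in> carrier G" "w \<otimes> g = y \<otimes> g \<otimes> inv y" by (auto simp: conj_class_def)
  then have "w = y \<otimes> g \<otimes> inv y \<otimes> inv g" using wG g(1) inv_solve_right[of w "y \<otimes> g \<otimes> inv y" g] by simp
  then have "w \<in> derived_set G (carrier G)" using y(1) g(1) by auto
  then have w: "w \<in> derived G (carrier G)" unfolding derived_def by (rule generate.incl)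
  have "u = inv x \<otimes> w \<otimes> inv (inv x)"
    using x(1) uG m_assoc[of "inv x" x u] by (simp add: w_def m_assoc)
  then show "u \<in> derived G (carrier G)"
    using w derived_self_is_normal x(1) normal_inv_iff[of "derived G (carrier G)"] by (metis inv_closed)
qed

text \<open>If \<open>K\<close> is everything then \<open>G\<close> is abelian, its classes are singletons, and only \<open>\<one>\<close> and \<open>b\<close>
  remain.\<close>

lemma K_proper_if_order_gt_2:
  assumes "card (carrier G) > 2"
  shows "K \<noteq> carrier G"
proof
  assume KG: "K = carrier G"
  obtain p where "elementary_abelian p (G\<lparr>carrier := K\<rparr>)"
    using single_class_normal_subgroup(3)[OF b_closed b_ne_one K_normal K_def] by blast
  then interpret K: comm_group "G\<lparr>carrier := K\<rparr>" by (simp add: elementary_abelian_def)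
  have "conj_class G b = {b}"
  proof -
    have "x \<otimes> b \<otimes> inv x = b" if "x \<in> carrier G" for x
      using K.m_comm[of x b] that b_closed KG conj_eq_commute[of x b] by simp
    then show ?thesis using conj_class_refl[OF b_closed] by (auto simp: conj_class_def)
  qed
  then show False using card_K KG assms by simp
qed

end

theorem lemma2p3:
  fixes G :: "('a, 'b) monoid_scheme" (structure)
    and k :: nat
    and \<chi> :: "nat \<Rightarrow> 'a \<Rightarrow> complex"
    and a b :: 'a
    and N :: "'a set"
  assumes "CD1_group G"
    and "Irr_enum G k \<chi>"
    and "columns_differ_once G a b"
    and "b \<noteq> \<one>"
    and "N = (\<Inter>i\<in>{1..<k}. char_ker G (\<chi> i))"
  shows "N = {\<one>} \<union> conj_class G b \<and>
    minimal_normal_subgroup G N \<and>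
    N \<subseteq> derived G (carrier G) \<and>
    (\<exists>p n. Factorial_Ring.prime p \<and> n > 0 \<and>
       group.ord G b = p \<and>
       card N = p ^ n \<and>
       card N = 1 + card (conj_class G b) \<and>
       card (conj_class G b) = p ^ n - 1 \<and>
       p ^ n - 1 \<ge> p - 1 \<and>
       elementary_abelian p (G\<lparr>carrier := N\<rparr>) \<and>
       \<not> p dvd card (conj_class G b))"
proof -
  have order: "card (carrier G) > 2" and "group G" "finite (carrier G)"
    using assms(1) by (auto simp: CD1_group_def Coset.order_def)
  then interpret finite_group G by (simp add: finite_group_def finite_group_axioms_def)
  obtain \<chi>\<^sub>0 where ab: "a \<in> carrier G" "b \<in> carrier G" and \<chi>0: "\<chi>\<^sub>0 \<in> Irr G" "\<chi>\<^sub>0 a \<noteq> \<chi>\<^sub>0 b"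
    and agree: "\<And>\<psi>. \<psi> \<in> Irr G \<Longrightarrow> \<psi> \<noteq> \<chi>\<^sub>0 \<Longrightarrow> \<psi> a = \<psi> b"
    using assms(3) by (auto simp: columns_differ_once_def)
  have a: "a = \<one>" using columns_differ_once_imp_one[OF ab \<chi>0 agree] assms(4) by simp
  have bij: "bij_betw \<chi> {1..k} (Irr G)" and first: "\<chi> 1 = principal_char G"
    and mono: "\<And>i j. 1 \<le> i \<Longrightarrow> i \<le> j \<Longrightarrow> j \<le> k \<Longrightarrow> Re (\<chi> i \<one>) \<le> Re (\<chi> j \<one>)"
    using assms(2) by (auto simp: Irr_enum_def)
  have inj: "\<chi> i = \<chi> j \<longleftrightarrow> i = j" if "i \<in> {1..k}" "j \<in> {1..k}" for i j
    using inj_on_eq_iff[OF bij_betw_imp_inj_on[OF bij] that] .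
  have surj: "\<chi> ` {1..k} = Irr G" using bij by (rule bij_betw_imp_surj_on)
  obtain j where j: "j \<in> {1..k}" "\<chi>\<^sub>0 = \<chi> j" using \<chi>0(1) unfolding surj[symmetric] by blast
  have in_Irr: "\<chi> i \<in> Irr G" if "i \<in> {1..k}" for i
    unfolding surj[symmetric] using that by (rule imageI)
  have "\<chi> 1 \<in> Irr G" using in_Irr[of 1] j(1) by simp
  then interpret cd1_columns G b \<chi>\<^sub>0
    using ab(2) assms(4) \<chi>0 agree a first by (simp add: cd1_columns_def cd1_columns_axioms_def finite_group_axioms)
  \<comment> \<open>a later character would have at least the degree of \<open>\<chi>\<^sub>0\<close> and would not be principal\<close>
  have jk: "j = k"
  proof (rule ccontr)
    assume "j \<noteq> k"
    then have "j < k" "1 \<le> j" using j(1) by auto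
    then have "\<chi> k \<noteq> \<chi>\<^sub>0" "\<chi> k \<noteq> principal_char G" "\<chi> k \<in> Irr G"
      using inj[of k j] inj[of k 1] in_Irr[of k] j first by auto
    then have "Re (\<chi> k \<one>) < Re (\<chi> j \<one>)" using \<chi>_degree_dominates[of "\<chi> k"] j(2) by simp
    then show False using mono[of j k] \<open>j < k\<close> \<open>1 \<le> j\<close> by simp
  qed
  \<comment> \<open>the index set is nonempty, so the intersection lies in \<open>carrier G\<close>\<close>
  have "k \<noteq> 1" using \<chi>_not_principal first j jk by auto
  then have k: "1 \<in> {1..<k}" using j by auto
  have others: "\<chi> ` {1..<k} = Irr G - {\<chi>\<^sub>0}"
  proof -
    have "{1..<k} = {1..k} - {k}" by auto
    moreover have "\<chi> ` ({1..k} - {k}) = \<chi> ` {1..k} - \<chi> ` {k}"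
      using bij_betw_imp_inj_on[OF bij] j(1) jk by (intro inj_on_image_set_diff) auto
    ultimately show ?thesis using surj j(2) jk by simp
  qed
  have "N = (\<Inter>\<psi>\<in>Irr G - {\<chi>\<^sub>0}. char_ker G \<psi>)"
    unfolding others[symmetric] assms(5) by simp
  also have "\<dots> = {g \<in> carrier G. \<forall>\<psi>\<in>Irr G. \<psi> \<noteq> \<chi>\<^sub>0 \<longrightarrow> \<psi> g = \<psi> \<one>}"
  proof -
    have "\<chi> 1 \<in> Irr G - {\<chi>\<^sub>0}" unfolding others[symmetric] using k by (rule imageI)
    then show ?thesis unfolding char_ker_def by blast
  qed
  also have "\<dots> = K" by (rule K_is_intersection_of_kernels[symmetric])
  finally have NK: "N = K" .
  then have N: "N = {\<one>} \<union> conj_class G b" by (simp add: K_def)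
  note single = single_class_normal_subgroup[OF b_closed b_ne_one K_normal[folded NK] N]
  obtain p n where pn: "Factorial_Ring.prime p" "n > 0" "group.ord G b = p" "card N = p ^ n"
    "elementary_abelian p (G\<lparr>carrier := N\<rparr>)" using single(3) by blast
  have card_class: "card (conj_class G b) = p ^ n - 1" and Suc: "p ^ n = 1 + card (conj_class G b)"
    using single(2) pn(4) by auto
  have "p \<ge> 1" using prime_ge_1_nat[OF pn(1)] .
  then have "p \<le> p ^ n" using pn(2) by (simp add: self_le_power)
  then have ge: "p ^ n - 1 \<ge> p - 1" by simp
  have ndvd: "\<not> p dvd card (conj_class G b)"
  proof
    assume "p dvd card (conj_class G b)"
    moreover have "p dvd 1 + card (conj_class G b)" using pn(2) unfolding Suc[symmetric] by simp
    ultimately have "p dvd 1" using dvd_add_left_iff by blast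
    then show False using pn(1) by (simp add: prime_nat_iff)
  qed
  have derived: "N \<subseteq> derived G (carrier G)"
    using K_subset_derived[OF K_proper_if_order_gt_2[OF order]] NK by simp
  show ?thesis
    by (intro conjI exI[of _ p] exI[of _ n]) (fact N single(1,2) derived pn card_class ge ndvd)+
qed

end
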